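(* Let $\phi_0=q^{1/2}\chi^{(2)}_{0,0}$, $\phi_1=q^{1/2}\chi^{(2)}_{-1,0}$ and $\phi_2=q^{1/2}\chi^{(2)}_{0,-1}$. The following identities hold in $\mathcal{H}(G,I)$: $$\phi_0*\phi_0=(q^{1/2}-q^{-1/2})\phi_0+\iota,\qquad \phi_1*\phi_1=(q^{1/2}-q^{-1/2})\phi_1+\iota,$$ $$\phi_0*\phi_1*\phi_2*\phi_0*\phi_1=\phi_2.$$
   Context: $F$ is a two-dimensional local field with last residue field $F_0=\mathbb{F}_q$, and $v:F^\times\to\mathbb{Z}^2$ is a fixed discrete valuation of rank two, where $\mathbb{Z}^2$ carries the lexicographic order from the right: $(i,j)<(k,l)$ iff $j<l$, or $j=l$ and $i<k$. $t_1,t_2$ are local parameters, with $v(t_1)=(1,0)$, $v(t_2)=(0,1)$. $O=\{x\in F: x=0 \text{ or } v(x)\ge(0,0)\}$, with $O/t_1O=\mathbb{F}_q$. $G=SL_2(F)$, and $I=\left\{\begin{pmatrix} a&b\\c&d\end{pmatrix}\in SL_2(O): c\in t_1O\right\}$. For $(i,j)\in\mathbb{Z}^2$ set $\eta^{(1)}_{i,j}=\begin{pmatrix} t_1^i t_2^j & 0\\ 0 & t_1^{-i}t_2^{-j}\end{pmatrix}$, $\eta^{(2)}_{i,j}=\begin{pmatrix} 0 & t_1^i t_2^j\\ -t_1^{-i}t_2^{-j} & 0\end{pmatrix}$, and $C^{(a)}_{i,j}=I\eta^{(a)}_{i,j}I$. By the (known) Bruhat decomposition, $G$ is the disjoint union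 of all the $C^{(a)}_{i,j}$, $a\in\{1,2\}$, $(i,j)\in\mathbb{Z}^2$. Let $\eta$ be the map on $G$ with $\eta(x)=\eta^{(a)}_{i,j}$ for $x\in C^{(a)}_{i,j}$. Let $\chi^{(a)}_{i,j}$ be the characteristic function of $C^{(a)}_{i,j}$, and $C_j=\bigcup_{m\in\mathbb{Z}}(C^{(1)}_{m,j}\cup C^{(2)}_{m,j})$. The convolution product is defined by $$(\chi^{(a)}_{i,j}*\chi^{(b)}_{k,l})(x)=\begin{cases} q^{-1}\sum_z \chi^{(a)}_{i,j}(\eta(x)z^{-1}) & \text{if } x\in C_{j+l}\text{ and } jl\ge0,\\ 0 & \text{otherwise,}\end{cases}$$ where $z$ runs over a set of representatives of the decomposition $C^{(b)}_{k,l}=\coprod_z Iz$ into right cosets of $I$; the sum has only finitely many nonzero terms for each $x$. $\mathcal{H}(G,I)$ is the $\mathbb{C}$-vector space generated by the functions $\sum_{r\le i}c_r\chi^{(a)}_{r,j}$ ($j>0$), $\sum_{r\ge i}c_r\chi^{(a)}_{r,j}$ ($j<0$), and $\sum_{i\le r\le i'}c_r\chi^{(a)}_{r,0}$, with $i,i',j\in\mathbb{Z}$, $a\in\{1,2\}$, $c_r\in\mathbb{C}$. The product $*$ is extended (infinite-)linearly to $\mathcal{H}(G,I)$, i.e. $(\sum_\alpha c_\alpha\alpha)*(\sum_\beta d_\beta\beta)=\sum_{\alpha,\beta}c_\alpha d_\beta\,\alpha*\beta$ for $\alpha,\beta$ running over the functions $\chi^{(a)}_{i,j}$, which is well-defined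 since only finitely many terms contribute to each coefficient. The element $\iota=q\chi^{(1)}_{0,0}$ is the identity. Products written without parentheses are evaluated from left to right: $x*y*w=(x*y)*w$. *)

theory Defs
  imports "HOL-Analysis.Analysis" "HOL-Library.Function_Algebras"
begin

section \<open>Two-dimensional local fields\<close>

text \<open>Valuations are total functions whose value at 0 is irrelevant (every use is guarded).
  Discrete valuations are normalised: the value group is all of the integers.\<close>

definition discrete_valuation :: "('f::field \<Rightarrow> int) \<Rightarrow> bool" where
  "discrete_valuation w \<longleftrightarrow>
     w ` (UNIV - {0}) = UNIV \<and>
     (\<forall>x y. x \<noteq> 0 \<longrightarrow> y \<noteq> 0 \<longrightarrow> w (x * y) = w x + w y) \<and>
     (\<forall>x y. x \<noteq> 0 \<longrightarrow> y \<noteq> 0 \<longrightarrow> x + y \<noteq> 0 \<longrightarrow> min (w x) (w y) \<le> w (x + y))"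

definition valuation_complete :: "('f::field \<Rightarrow> int) \<Rightarrow> bool" where
  "valuation_complete w \<longleftrightarrow>
     (\<forall>s :: nat \<Rightarrow> 'f.
        (\<forall>N. \<exists>M. \<forall>m\<ge>M. \<forall>n\<ge>M. s m = s n \<or> N \<le> w (s m - s n)) \<longrightarrow>
        (\<exists>l. \<forall>N. \<exists>M. \<forall>n\<ge>M. s n = l \<or> N \<le> w (s n - l)))"

definition valuation_ring :: "('f::field \<Rightarrow> int) \<Rightarrow> 'f set" where
  "valuation_ring w = {x. x = 0 \<or> 0 \<le> w x}"

text \<open>The residue field is given as a type \<open>'k\<close> with the reduction map: a surjective unital ring
  homomorphism on the valuation ring whose kernel is the maximal ideal.\<close>

definition residue_map :: "('f::field \<Rightarrow> int) \<Rightarrow> ('f \<Rightarrow> 'k::field) \<Rightarrow> bool" where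
  "residue_map w r \<longleftrightarrow>
     r ` valuation_ring w = UNIV \<and> r 1 = 1 \<and>
     (\<forall>x\<in>valuation_ring w. \<forall>y\<in>valuation_ring w.
        r (x + y) = r x + r y \<and> r (x * y) = r x * r y) \<and>
     (\<forall>x\<in>valuation_ring w. r x = 0 \<longleftrightarrow> x = 0 \<or> 0 < w x)"

text \<open>\<open>'f\<close>, \<open>'k1\<close>, \<open>'k0\<close> are the field itself, its first residue field and the (finite) last
  residue field.\<close>

definition two_dim_local_field ::
  "('f::field \<Rightarrow> int) \<Rightarrow> ('f \<Rightarrow> 'k1::field) \<Rightarrow> ('k1 \<Rightarrow> int) \<Rightarrow> ('k1 \<Rightarrow> 'k0::{field,finite}) \<Rightarrow> bool"
where
  "two_dim_local_field w r1 u r0 \<longleftrightarrow>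
     discrete_valuation w \<and> valuation_complete w \<and> residue_map w r1 \<and>
     discrete_valuation u \<and> valuation_complete u \<and> residue_map u r0"

text \<open>Lexicographic order from the right; this is not the order of \<open>HOL-Library.Product_Lexorder\<close>.\<close>

definition rlex_less :: "int \<times> int \<Rightarrow> int \<times> int \<Rightarrow> bool" where
  "rlex_less p p' \<longleftrightarrow> snd p < snd p' \<or> (snd p = snd p' \<and> fst p < fst p')"

definition rlex_le :: "int \<times> int \<Rightarrow> int \<times> int \<Rightarrow> bool" where
  "rlex_le p p' \<longleftrightarrow> rlex_less p p' \<or> p = p'"

text \<open>A discrete valuation of rank two on a two-dimensional local field: its second component is
  the valuation \<open>w\<close> of the field, and on \<open>w\<close>-units its first component is the valuation \<open>u\<close> of the
  residue. (The first component elsewhere depends on the choice of a uniformiser of \<open>w\<close>.)\<close>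

definition rank_two_valuation ::
  "('f::field \<Rightarrow> int) \<Rightarrow> ('f \<Rightarrow> 'k1::field) \<Rightarrow> ('k1 \<Rightarrow> int) \<Rightarrow> ('f \<Rightarrow> int \<times> int) \<Rightarrow> bool"
where
  "rank_two_valuation w r1 u v \<longleftrightarrow>
     v ` (UNIV - {0}) = UNIV \<and>
     (\<forall>x y. x \<noteq> 0 \<longrightarrow> y \<noteq> 0 \<longrightarrow> v (x * y) = v x + v y) \<and>
     (\<forall>x y. x \<noteq> 0 \<longrightarrow> y \<noteq> 0 \<longrightarrow> x + y \<noteq> 0 \<longrightarrow>
        rlex_le (v x) (v (x + y)) \<or> rlex_le (v y) (v (x + y))) \<and>
     (\<forall>x. x \<noteq> 0 \<longrightarrow> snd (v x) = w x) \<and>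
     (\<forall>x. x \<noteq> 0 \<longrightarrow> w x = 0 \<longrightarrow> fst (v x) = u (r1 x))"

definition local_parameters :: "('f::field \<Rightarrow> int \<times> int) \<Rightarrow> 'f \<Rightarrow> 'f \<Rightarrow> bool" where
  "local_parameters v t1 t2 \<longleftrightarrow> t1 \<noteq> 0 \<and> t2 \<noteq> 0 \<and> v t1 = (1, 0) \<and> v t2 = (0, 1)"

definition rank_two_ring :: "('f::field \<Rightarrow> int \<times> int) \<Rightarrow> 'f set" where
  "rank_two_ring v = {x. x = 0 \<or> rlex_le (0, 0) (v x)}"

section \<open>Double cosets of the Iwahori subgroup\<close>

definition mat2 :: "'f::field \<Rightarrow> 'f \<Rightarrow> 'f \<Rightarrow> 'f \<Rightarrow> 'f^2^2" where
  "mat2 a b c d = vector [vector [a, b], vector [c, d]]"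

definition SL2 :: "('f::field^2^2) set" where
  "SL2 = {A. det A = 1}"

definition iwahori :: "('f::field \<Rightarrow> int \<times> int) \<Rightarrow> 'f \<Rightarrow> ('f^2^2) set" where
  "iwahori v t1 = {A \<in> SL2. (\<forall>m n. A $ m $ n \<in> rank_two_ring v) \<and>
                            A $ 2 $ 1 \<in> (\<lambda>y. t1 * y) ` rank_two_ring v}"

text \<open>An index \<open>(a, i, j)\<close> stands for the superscript \<open>a \<in> {1,2}\<close> and the subscripts \<open>i, j\<close>;
  the superscript lives in the two-element type \<open>2\<close>, whose elements are \<open>1\<close> and \<open>2\<close>.\<close>

type_synonym bruhat_index = "2 \<times> int \<times> int"

fun eta_rep :: "'f::field \<Rightarrow> 'f \<Rightarrow> bruhat_index \<Rightarrow> 'f^2^2" where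
  "eta_rep t1 t2 (a, i, j) =
     (if a = 1
      then mat2 (t1 powi i * t2 powi j) 0 0 (t1 powi (-i) * t2 powi (-j))
      else mat2 0 (t1 powi i * t2 powi j) (- (t1 powi (-i) * t2 powi (-j))) 0)"

definition dcoset :: "('f::field \<Rightarrow> int \<times> int) \<Rightarrow> 'f \<Rightarrow> 'f \<Rightarrow> bruhat_index \<Rightarrow> ('f^2^2) set" where
  "dcoset v t1 t2 \<alpha> =
     {g ** eta_rep t1 t2 \<alpha> ** h | g h. g \<in> iwahori v t1 \<and> h \<in> iwahori v t1}"

text \<open>Well defined on \<open>SL2\<close> by the Bruhat decomposition.\<close>

definition eta_map :: "('f::field \<Rightarrow> int \<times> int) \<Rightarrow> 'f \<Rightarrow> 'f \<Rightarrow> 'f^2^2 \<Rightarrow> 'f^2^2" where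
  "eta_map v t1 t2 x = (THE e. \<exists>\<alpha>. x \<in> dcoset v t1 t2 \<alpha> \<and> e = eta_rep t1 t2 \<alpha>)"

definition level_set :: "('f::field \<Rightarrow> int \<times> int) \<Rightarrow> 'f \<Rightarrow> 'f \<Rightarrow> int \<Rightarrow> ('f^2^2) set" where
  "level_set v t1 t2 j = (\<Union>m. dcoset v t1 t2 (1, m, j) \<union> dcoset v t1 t2 (2, m, j))"

text \<open>Functions on \<open>SL2\<close> are represented as functions on all matrices that vanish off \<open>SL2\<close>.\<close>

definition chi :: "('f::field \<Rightarrow> int \<times> int) \<Rightarrow> 'f \<Rightarrow> 'f \<Rightarrow> bruhat_index \<Rightarrow> 'f^2^2 \<Rightarrow> complex" where
  "chi v t1 t2 \<alpha> = indicator (dcoset v t1 t2 \<alpha>)"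

section \<open>The Hecke algebra\<close>

text \<open>Sum of a family with finitely many nonzero terms over a possibly infinite index set.\<close>

definition fsum :: "('i \<Rightarrow> 'c::comm_monoid_add) \<Rightarrow> 'i set \<Rightarrow> 'c" where
  "fsum f A = sum f {i \<in> A. f i \<noteq> 0}"

definition iwahori_rcoset :: "('f::field \<Rightarrow> int \<times> int) \<Rightarrow> 'f \<Rightarrow> 'f^2^2 \<Rightarrow> ('f^2^2) set" where
  "iwahori_rcoset v t1 z = (\<lambda>h. h ** z) ` iwahori v t1"

definition rcoset_reps :: "('f::field \<Rightarrow> int \<times> int) \<Rightarrow> 'f \<Rightarrow> ('f^2^2) set \<Rightarrow> ('f^2^2) set \<Rightarrow> bool" where
  "rcoset_reps v t1 S Z \<longleftrightarrow>
     S = (\<Union>z\<in>Z. iwahori_rcoset v t1 z) \<and> disjoint_family_on (iwahori_rcoset v t1) Z"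

text \<open>The product of two characteristic functions. The value does not depend on the chosen set of
  representatives, since \<open>chi v t1 t2 \<alpha>\<close> is invariant under right translation by the Iwahori
  subgroup.\<close>

definition chi_conv ::
  "('f::field \<Rightarrow> int \<times> int) \<Rightarrow> 'f \<Rightarrow> 'f \<Rightarrow> nat \<Rightarrow> bruhat_index \<Rightarrow> bruhat_index \<Rightarrow> 'f^2^2 \<Rightarrow> complex"
where
  "chi_conv v t1 t2 q \<alpha> \<beta> x =
     (let j = snd (snd \<alpha>); l = snd (snd \<beta>);
          Z = (SOME Z. rcoset_reps v t1 (dcoset v t1 t2 \<beta>) Z)
      in if x \<in> level_set v t1 t2 (j + l) \<and> 0 \<le> j * l
         then inverse (of_nat q) *
              fsum (\<lambda>z. chi v t1 t2 \<alpha> (eta_map v t1 t2 x ** matrix_inv z)) Z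
         else 0)"

text \<open>The possibly infinite linear combination of characteristic functions with coefficients
  \<open>c\<close>, pointwise: at most one term is nonzero at each point, as double cosets are disjoint.\<close>

definition chi_comb ::
  "('f::field \<Rightarrow> int \<times> int) \<Rightarrow> 'f \<Rightarrow> 'f \<Rightarrow> (bruhat_index \<Rightarrow> complex) \<Rightarrow> 'f^2^2 \<Rightarrow> complex"
where
  "chi_comb v t1 t2 c x = fsum (\<lambda>\<alpha>. c \<alpha> * chi v t1 t2 \<alpha> x) UNIV"

text \<open>The coefficients are unique, as the double cosets are disjoint and nonempty.\<close>

definition chi_coeff ::
  "('f::field \<Rightarrow> int \<times> int) \<Rightarrow> 'f \<Rightarrow> 'f \<Rightarrow> ('f^2^2 \<Rightarrow> complex) \<Rightarrow> bruhat_index \<Rightarrow> complex"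
where
  "chi_coeff v t1 t2 f = (THE c. f = chi_comb v t1 t2 c)"

definition hecke_mult ::
  "('f::field \<Rightarrow> int \<times> int) \<Rightarrow> 'f \<Rightarrow> 'f \<Rightarrow> nat \<Rightarrow>
   ('f^2^2 \<Rightarrow> complex) \<Rightarrow> ('f^2^2 \<Rightarrow> complex) \<Rightarrow> 'f^2^2 \<Rightarrow> complex"
where
  "hecke_mult v t1 t2 q f g x =
     fsum (\<lambda>(\<alpha>, \<beta>). chi_coeff v t1 t2 f \<alpha> * chi_coeff v t1 t2 g \<beta> * chi_conv v t1 t2 q \<alpha> \<beta> x) UNIV"

definition fun_scale :: "complex \<Rightarrow> ('x \<Rightarrow> complex) \<Rightarrow> 'x \<Rightarrow> complex"  (infixr "\<cdot>\<^sub>f" 75) where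
  "fun_scale c f = (\<lambda>x. c * f x)"

definition hecke_generators ::
  "('f::field \<Rightarrow> int \<times> int) \<Rightarrow> 'f \<Rightarrow> 'f \<Rightarrow> ('f^2^2 \<Rightarrow> complex) set"
where
  "hecke_generators v t1 t2 =
     {chi_comb v t1 t2 c | c a i j. 0 < j \<and> (\<forall>\<alpha>. c \<alpha> \<noteq> 0 \<longrightarrow> (\<exists>r\<le>i. \<alpha> = (a, r, j)))} \<union>
     {chi_comb v t1 t2 c | c a i j. j < 0 \<and> (\<forall>\<alpha>. c \<alpha> \<noteq> 0 \<longrightarrow> (\<exists>r\<ge>i. \<alpha> = (a, r, j)))} \<union>
     {chi_comb v t1 t2 c | c a i i'. \<forall>\<alpha>. c \<alpha> \<noteq> 0 \<longrightarrow> (\<exists>r\<in>{i..i'}. \<alpha> = (a, r, 0))}"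

definition hecke_space ::
  "('f::field \<Rightarrow> int \<times> int) \<Rightarrow> 'f \<Rightarrow> 'f \<Rightarrow> ('f^2^2 \<Rightarrow> complex) set"
where
  "hecke_space v t1 t2 = module.span fun_scale (hecke_generators v t1 t2)"

end

theory Submission
  imports Defs
begin

text \<open>
  Write \<open>C(\<alpha>)\<close> for the double coset \<open>I \<eta>\<^sub>\<alpha> I\<close>. The value of \<open>\<chi>\<^sub>\<alpha> * \<chi>\<^sub>\<beta>\<close> at \<open>\<eta>\<^sub>\<gamma>\<close> is \<open>1/q\<close> times the
  number of right cosets of \<open>I\<close> inside the intersection of \<open>C(\<beta>)\<close> with \<open>C(\<alpha>)\<inverse> \<eta>\<^sub>\<gamma>\<close>, as long as
  the levels (the exponents of \<open>t2\<close>) add up and have no opposite signs. Each identity thus becomes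
  a count of cosets, which are told apart by the disjointness of the double cosets.

  Let \<open>s\<^sub>0 = \<eta>(2,0,0)\<close> and \<open>s\<^sub>1 = \<eta>(2,-1,0)\<close>. These are the two simple reflections of level \<open>0\<close>, and for
  each of them \<open>C(s)\<close> is the union of \<open>q\<close> right cosets \<open>I s u\<close>, with \<open>u\<close> in a root subgroup \<open>U\<close> modulo a
  smaller one. As in the classical Iwahori-Hecke algebra there are two cases. When
  \<open>\<eta>\<^sub>\<alpha> U \<eta>\<^sub>\<alpha>\<inverse>\<close> lies in \<open>I\<close>, the length adds up and \<open>\<chi>\<^sub>\<alpha> * \<chi>\<^sub>s = \<chi>(\<alpha>s) / q\<close>
  (\<open>conv_length_additive\<close>). When \<open>\<alpha> = s\<close>, the rank one relation gives
  \<open>\<chi>\<^sub>s * \<chi>\<^sub>s = \<chi>\<^sub>1 + (q - 1)/q \<chi>\<^sub>s\<close> (\<open>conv_quadratic\<close>), which is the quadratic relation for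
  \<open>\<phi> = \<surd>q \<chi>\<^sub>s\<close>.

  For the last identity, \<open>s\<^sub>0 s\<^sub>1\<close> is up to sign the translation \<open>\<eta>(1,1,0)\<close>, so that
  \<open>\<phi>\<^sub>0 * \<phi>\<^sub>1 = \<chi>(1,1,0)\<close>. On a negative level this translation shortens: all \<open>q\<^sup>2\<close> right cosets of
  \<open>C(1,1,0)\<inverse>\<close> are carried by \<open>\<eta>\<^sub>\<gamma>\<close> into one and the same double coset, whence
  \<open>\<chi>(1,1,0) * \<chi>(a,i,j) = q \<chi>(a,i+1,j)\<close> for \<open>j < 0\<close> (\<open>conv_translation\<close>). The additional terms of the
  classical product would lie on level \<open>-j\<close> and are cut off by the level condition. Two further
  steps of additive length lead back to \<open>\<phi>\<^sub>2\<close>: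
  \<open>\<chi>(1,1,0) * \<phi>\<^sub>2 = q\<^sup>3\<^sup>/\<^sup>2 \<chi>(2,1,-1)\<close>, then \<open>q \<chi>(1,1,-1)\<close>, then \<open>q\<^sup>1\<^sup>/\<^sup>2 \<chi>(2,0,-1)\<close>.
\<close>

section \<open>Matrices of size two\<close>

lemma mat2_entries [simp]:
  "mat2 a b c d $ 1 $ 1 = a" "mat2 a b c d $ 1 $ 2 = b"
  "mat2 a b c d $ 2 $ 1 = c" "mat2 a b c d $ 2 $ 2 = d"
  by (simp_all add: mat2_def)

lemma mat2_eq_iff: "mat2 a b c d = mat2 a' b' c' d' \<longleftrightarrow> a = a' \<and> b = b' \<and> c = c' \<and> d = d'"
  by (metis mat2_entries)

lemma mat2_cases: obtains a b c d where "A = mat2 a b c d"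
proof
  show "A = mat2 (A $ 1 $ 1) (A $ 1 $ 2) (A $ 2 $ 1) (A $ 2 $ 2)"
    by (simp add: vec_eq_iff forall_2)
qed

lemma mat2_mult [simp]:
  "mat2 a b c d ** mat2 a' b' c' d' =
   mat2 (a * a' + b * c') (a * b' + b * d') (c * a' + d * c') (c * b' + d * d')"
  by (simp add: vec_eq_iff forall_2 matrix_matrix_mult_def sum_2)

lemma mat2_det [simp]: "det (mat2 a b c d) = a * d - b * c"
  by (simp add: det_2)

lemma mat2_one: "mat2 1 0 0 1 = mat 1"
  by (simp add: vec_eq_iff forall_2 mat_def)

lemma SL2_inv:
  fixes A :: "'f::field^2^2"
  assumes "A \<in> SL2"
  shows "A ** matrix_inv A = mat 1" "matrix_inv A ** A = mat 1"
proof -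
  have "invertible A" using assms by (simp add: SL2_def invertible_det_nz)
  then have "\<exists>B. A ** B = mat 1 \<and> B ** A = mat 1" by (simp add: invertible_def)
  then have "A ** matrix_inv A = mat 1 \<and> matrix_inv A ** A = mat 1"
    unfolding matrix_inv_def by (rule someI_ex)
  then show "A ** matrix_inv A = mat 1" "matrix_inv A ** A = mat 1" by auto
qed

section \<open>The ring of integers and its residue field\<close>

text \<open>The two residue maps enter through their composite \<open>\<rho>\<close>, the reduction of the rank two ring \<open>\<O>\<close>
  onto the last residue field. It identifies \<open>\<O>\<close> modulo its maximal ideal with that field, so that
  counting residues produces powers of \<open>q\<close>.\<close>

locale rank_two_residue =
  fixes v :: "'f::field \<Rightarrow> int \<times> int" and t1 t2 :: 'f and \<rho> :: "'f \<Rightarrow> 'k::{field,finite}"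
  assumes v_mult: "\<And>x y. x \<noteq> 0 \<Longrightarrow> y \<noteq> 0 \<Longrightarrow> v (x * y) = v x + v y"
    and v_add: "\<And>x y. x \<noteq> 0 \<Longrightarrow> y \<noteq> 0 \<Longrightarrow> x + y \<noteq> 0 \<Longrightarrow>
                  rlex_le (v x) (v (x + y)) \<or> rlex_le (v y) (v (x + y))"
    and params: "local_parameters v t1 t2"
    and \<rho>_surj: "\<rho> ` rank_two_ring v = UNIV"
    and \<rho>_add: "\<And>x y. x \<in> rank_two_ring v \<Longrightarrow> y \<in> rank_two_ring v \<Longrightarrow> \<rho> (x + y) = \<rho> x + \<rho> y"
    and \<rho>_zero: "\<And>x. x \<in> rank_two_ring v \<Longrightarrow> \<rho> x = 0 \<longleftrightarrow> x = 0 \<or> rlex_less (0, 0) (v x)"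
begin

abbreviation "\<O> \<equiv> rank_two_ring v"
definition max_ideal :: "'f set" ("\<M>") where "\<M> = {x. x = 0 \<or> rlex_less (0, 0) (v x)}"

lemma t_nonzero [simp]: "t1 \<noteq> 0" "t2 \<noteq> 0" and v_t: "v t1 = (1,0)" "v t2 = (0,1)"
  using params by (auto simp: local_parameters_def)

lemma O_iff: "x \<in> \<O> \<longleftrightarrow> x = 0 \<or> 0 < snd (v x) \<or> (snd (v x) = 0 \<and> 0 \<le> fst (v x))"
  by (auto simp: rank_two_ring_def rlex_le_def rlex_less_def prod_eq_iff)

lemma M_iff: "x \<in> \<M> \<longleftrightarrow> x = 0 \<or> 0 < snd (v x) \<or> (snd (v x) = 0 \<and> 0 < fst (v x))"
  by (auto simp: max_ideal_def rlex_less_def)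

lemma v_one [simp]: "v 1 = 0"
  using v_mult[of 1 1] by simp

lemma v_minus [simp]: "v (- x) = v x"
proof (cases "x = 0")
  case False
  have "v (-1) + v (-1) = 0" using v_mult[of "-1" "-1"] by simp
  then have "v (-1) = 0" by (simp add: prod_eq_iff)
  then show ?thesis using False v_mult[of "-1" x] by simp
qed simp

lemma v_inverse: "x \<noteq> 0 \<Longrightarrow> v (inverse x) = - v x"
  using v_mult[of x "inverse x"] by (simp add: eq_neg_iff_add_eq_0 add.commute)

lemma v_powi: "x \<noteq> 0 \<Longrightarrow> v (x powi n) = (n * fst (v x), n * snd (v x))"
proof (induction n rule: int_induct[where k=0])
  case base then show ?case by (simp add: zero_prod_def)
next
  case (step1 i)
  then show ?case by (simp add: power_int_add v_mult prod_eq_iff algebra_simps)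
next
  case (step2 i)
  then show ?case
    by (simp add: power_int_diff v_mult divide_inverse v_inverse prod_eq_iff algebra_simps)
qed

lemma v_param: "v (t1 powi i * t2 powi j) = (i, j)"
  by (simp add: v_mult v_powi v_t)

lemma O_0 [simp]: "0 \<in> \<O>" and O_1 [simp]: "1 \<in> \<O>" and M_0 [simp]: "0 \<in> \<M>"
  by (auto simp: O_iff M_iff)

lemma M_imp_O: "x \<in> \<M> \<Longrightarrow> x \<in> \<O>"
  by (auto simp: O_iff M_iff)

lemma O_minus [simp]: "- x \<in> \<O> \<longleftrightarrow> x \<in> \<O>" and M_minus [simp]: "- x \<in> \<M> \<longleftrightarrow> x \<in> \<M>"
  by (auto simp: O_iff M_iff)

lemma O_add: "x \<in> \<O> \<Longrightarrow> y \<in> \<O> \<Longrightarrow> x + y \<in> \<O>"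
  using v_add[of x y] unfolding O_iff rlex_le_def rlex_less_def
  by (cases "x = 0"; cases "y = 0"; cases "x + y = 0"; force)

lemma M_add: "x \<in> \<M> \<Longrightarrow> y \<in> \<M> \<Longrightarrow> x + y \<in> \<M>"
  using v_add[of x y] unfolding M_iff rlex_le_def rlex_less_def
  by (cases "x = 0"; cases "y = 0"; cases "x + y = 0"; force)

lemma O_diff: "x \<in> \<O> \<Longrightarrow> y \<in> \<O> \<Longrightarrow> x - y \<in> \<O>"
  using O_add[of x "- y"] by simp

lemma M_diff: "x \<in> \<M> \<Longrightarrow> y \<in> \<M> \<Longrightarrow> x - y \<in> \<M>"
  using M_add[of x "- y"] by simp

lemma O_mult: "x \<in> \<O> \<Longrightarrow> y \<in> \<O> \<Longrightarrow> x * y \<in> \<O>"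
  by (cases "x = 0"; cases "y = 0") (auto simp: O_iff v_mult)

lemma M_mult_left: "x \<in> \<M> \<Longrightarrow> y \<in> \<O> \<Longrightarrow> x * y \<in> \<M>"
  by (cases "x = 0"; cases "y = 0") (auto simp: O_iff M_iff v_mult)

lemma M_mult_right: "x \<in> \<O> \<Longrightarrow> y \<in> \<M> \<Longrightarrow> x * y \<in> \<M>"
  using M_mult_left[of y x] by (simp add: mult.commute)

lemma one_notin_M [simp]: "1 \<notin> \<M>"
  by (simp add: M_iff)

lemma unit_iff: "x \<in> \<O> \<and> x \<notin> \<M> \<longleftrightarrow> x \<noteq> 0 \<and> v x = 0"
  by (auto simp: O_iff M_iff prod_eq_iff)

lemma unit_inverse: "x \<in> \<O> \<Longrightarrow> x \<notin> \<M> \<Longrightarrow> inverse x \<in> \<O>"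
  using unit_iff[of x] by (simp add: O_iff v_inverse)

lemma unit_divide: "x \<in> \<O> \<Longrightarrow> x \<notin> \<M> \<Longrightarrow> y \<in> \<O> \<Longrightarrow> y / x \<in> \<O>"
  by (simp add: divide_inverse O_mult unit_inverse)

lemma t1_M: "t1 \<in> \<M>"
  by (simp add: M_iff v_t)

lemma M_eq_t1_O: "t1 * x \<in> \<M> \<longleftrightarrow> x \<in> \<O>"
  by (cases "x = 0") (auto simp: O_iff M_iff v_mult v_t)

lemma divide_t1: "x / t1 \<in> \<O> \<longleftrightarrow> x \<in> \<M>"
  using M_eq_t1_O[of "x / t1"] by simp

lemma \<rho>_eq_iff:
  assumes "x \<in> \<O>" "y \<in> \<O>"
  shows "\<rho> x = \<rho> y \<longleftrightarrow> x - y \<in> \<M>"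
proof -
  have "\<rho> x = \<rho> (x - y) + \<rho> y"
    using \<rho>_add[of "x - y" y] assms by (simp add: O_diff)
  then show ?thesis
    using \<rho>_zero[of "x - y"] assms by (auto simp: O_diff max_ideal_def)
qed

text \<open>The lifts form a system of representatives of \<open>\<O>\<close> modulo \<open>\<M>\<close>; the finite lists of right
  cosets below are indexed by them.\<close>
definition lift :: "'k \<Rightarrow> 'f" where "lift k = (SOME x. x \<in> \<O> \<and> \<rho> x = k)"

lemma lift: "lift k \<in> \<O>" "\<rho> (lift k) = k"
proof -
  have "\<exists>x. x \<in> \<O> \<and> \<rho> x = k" using \<rho>_surj by (metis UNIV_I imageE)
  then have "lift k \<in> \<O> \<and> \<rho> (lift k) = k" unfolding lift_def by (rule someI_ex)
  then show "lift k \<in> \<O>" "\<rho> (lift k) = k" by auto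
qed

lemma lift_diff_M: "lift k - lift l \<in> \<M> \<longleftrightarrow> k = l"
  using \<rho>_eq_iff[of "lift k" "lift l"] by (simp add: lift)

lemma lift_M: "lift k \<in> \<M> \<longleftrightarrow> k = 0"
proof -
  have "\<rho> 0 = 0" using \<rho>_zero[of 0] by simp
  then show ?thesis using \<rho>_eq_iff[of "lift k" 0] by (simp add: lift)
qed

lemma lift_residue: "x \<in> \<O> \<Longrightarrow> x - lift (\<rho> x) \<in> \<M>"
  using \<rho>_eq_iff[of x "lift (\<rho> x)"] by (simp add: lift)

section \<open>The Iwahori subgroup and its double cosets\<close>

abbreviation "I \<equiv> iwahori v t1"
abbreviation "D \<equiv> dcoset v t1 t2"
abbreviation "E \<equiv> eta_rep t1 t2"

lemma mat2_in_iwahori: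
  "mat2 a b c d \<in> I \<longleftrightarrow> a \<in> \<O> \<and> b \<in> \<O> \<and> c \<in> \<M> \<and> d \<in> \<O> \<and> a * d - b * c = 1"
proof -
  have "c \<in> (\<lambda>y. t1 * y) ` \<O> \<longleftrightarrow> c \<in> \<M>" for c
    using divide_t1[of c] by (auto simp: M_eq_t1_O intro!: image_eqI[of c _ "c / t1"])
  then show ?thesis
    by (auto simp: iwahori_def SL2_def forall_2 M_imp_O)
qed

text \<open>Since the lower left entry lies in \<open>\<M>\<close>, the determinant condition makes the diagonal entries
  units. This is what forces the double cosets apart and what allows division when matrices are
  factored below.\<close>
lemma I_cases:
  assumes "h \<in> I"
  obtains a b c d where "h = mat2 a b c d" "a \<in> \<O>" "b \<in> \<O>" "c \<in> \<M>" "d \<in> \<O>" "a * d - b * c = 1"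
    "a \<notin> \<M>" "d \<notin> \<M>"
proof -
  obtain a b c d where h: "h = mat2 a b c d" by (rule mat2_cases)
  then have *: "a \<in> \<O>" "b \<in> \<O>" "c \<in> \<M>" "d \<in> \<O>" "a * d - b * c = 1"
    using assms mat2_in_iwahori by auto
  have "a * d \<notin> \<M>"
  proof
    assume "a * d \<in> \<M>"
    then have "a * d - b * c \<in> \<M>" using M_diff[OF _ M_mult_right[OF *(2,3)]] by blast
    then show False using *(5) by simp
  qed
  then have "a \<notin> \<M>" "d \<notin> \<M>" using * M_mult_left[of a d] M_mult_right[of a d] by auto
  then show thesis using that h * by blast
qed

lemma I_SL2: "h \<in> I \<Longrightarrow> h \<in> SL2"
  by (simp add: iwahori_def)

lemma I_one [simp]: "mat 1 \<in> I"
  by (simp add: mat2_in_iwahori flip: mat2_one)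

lemma I_mult: assumes "g \<in> I" "h \<in> I" shows "g ** h \<in> I"
proof -
  have "det (g ** h) = 1" using assms by (simp add: det_mul iwahori_def SL2_def)
  moreover obtain a b c d where g: "g = mat2 a b c d" "a \<in> \<O>" "b \<in> \<O>" "c \<in> \<M>" "d \<in> \<O>"
    using assms(1) by (rule I_cases)
  moreover obtain a' b' c' d' where
    h: "h = mat2 a' b' c' d'" "a' \<in> \<O>" "b' \<in> \<O>" "c' \<in> \<M>" "d' \<in> \<O>"
    using assms(2) by (rule I_cases)
  moreover have "c * a' + d * c' \<in> \<M>"
    using g h by (intro M_add M_mult_left M_mult_right)
  ultimately show ?thesis
    by (auto simp: mat2_in_iwahori O_add O_mult M_imp_O)
qed

lemma I_inv: assumes "h \<in> I" obtains h' where "h' \<in> I" "h ** h' = mat 1" "h' ** h = mat 1"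
proof -
  obtain a b c d where h: "h = mat2 a b c d" "a \<in> \<O>" "b \<in> \<O>" "c \<in> \<M>" "d \<in> \<O>" "a * d - b * c = 1"
    using assms by (rule I_cases)
  show thesis
    by (rule that[of "mat2 d (-b) (-c) a"])
       (use h in \<open>auto simp: mat2_in_iwahori algebra_simps simp flip: mat2_one\<close>)
qed

lemma eta_rep_SL2: "E \<alpha> \<in> SL2"
  by (cases \<alpha>) (auto simp: SL2_def power_int_minus field_simps)

lemma SL2_mult: "g \<in> SL2 \<Longrightarrow> h \<in> SL2 \<Longrightarrow> g ** h \<in> (SL2 :: ('f^2^2) set)"
  by (simp add: SL2_def det_mul)

lemma dcoset_SL2: "x \<in> D \<alpha> \<Longrightarrow> x \<in> SL2"
  by (auto simp: dcoset_def SL2_mult I_SL2 eta_rep_SL2)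

lemma dcosetI: "g \<in> I \<Longrightarrow> h \<in> I \<Longrightarrow> g ** E \<alpha> ** h \<in> D \<alpha>"
  by (auto simp: dcoset_def)

lemma eta_rep_in_dcoset [simp]: "E \<alpha> \<in> D \<alpha>"
  using dcosetI[of "mat 1" "mat 1" \<alpha>] by simp

lemma dcoset_left_mult: "x \<in> D \<alpha> \<Longrightarrow> h \<in> I \<Longrightarrow> h ** x \<in> D \<alpha>"
  unfolding dcoset_def by (auto simp: matrix_mul_assoc) (metis I_mult)

lemma dcoset_right_mult: "x \<in> D \<alpha> \<Longrightarrow> h \<in> I \<Longrightarrow> x ** h \<in> D \<alpha>"
  unfolding dcoset_def by (auto simp flip: matrix_mul_assoc) (metis I_mult)

lemma dcoset_cases:
  assumes "x \<in> D \<alpha>" obtains g h where "g \<in> I" "h \<in> I" "x = g ** E \<alpha> ** h"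
  using assms by (auto simp: dcoset_def)

text \<open>Comparing entries in \<open>\<eta>\<^sub>\<alpha> h' = g \<eta>\<^sub>\<beta>\<close> suffices. With equal superscripts, an entry gives a ratio
  of the two parameters that is a unit. With different superscripts, one parameter divided by the
  other lies in \<open>\<O>\<close> and the reciprocal lies in \<open>\<M>\<close>, so that \<open>1\<close> would lie in \<open>\<M>\<close>.\<close>
lemma eta_rep_in_dcoset_unique:
  assumes "E \<alpha> \<in> D \<beta>" shows "\<alpha> = \<beta>"
proof -
  obtain g h where "g \<in> I" "h \<in> I" and eq: "E \<alpha> = g ** E \<beta> ** h" using assms by (rule dcoset_cases)
  obtain h' where h': "h' \<in> I" "h ** h' = mat 1" using \<open>h \<in> I\<close> by (rule I_inv)
  have main: "E \<alpha> ** h' = g ** E \<beta>"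
    unfolding eq using h' by (simp flip: matrix_mul_assoc)
  obtain a i j where \<alpha>: "\<alpha> = (a, i, j)" by (cases \<alpha>)
  obtain b k l where \<beta>: "\<beta> = (b, k, l)" by (cases \<beta>)
  define e where "e = t1 powi i * t2 powi j"
  define f where "f = t1 powi k * t2 powi l"
  have [simp]: "e \<noteq> 0" "f \<noteq> 0" by (auto simp: e_def f_def)
  have ve: "v e = (i, j)" "v f = (k, l)" by (auto simp: e_def f_def v_param)
  have Ea: "E \<alpha> = (if a = 1 then mat2 e 0 0 (inverse e) else mat2 0 e (- inverse e) 0)"
    by (simp add: \<alpha> e_def power_int_minus)
  have Eb: "E \<beta> = (if b = 1 then mat2 f 0 0 (inverse f) else mat2 0 f (- inverse f) 0)"
    by (simp add: \<beta> f_def power_int_minus)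
  obtain a1 b1 c1 d1 where g: "g = mat2 a1 b1 c1 d1" "a1 \<in> \<O>" "b1 \<in> \<O>" "c1 \<in> \<M>" "d1 \<in> \<O>"
     "a1 \<notin> \<M>" "d1 \<notin> \<M>" using \<open>g \<in> I\<close> by (rule I_cases)
  obtain a2 b2 c2 d2 where h: "h' = mat2 a2 b2 c2 d2" "a2 \<in> \<O>" "b2 \<in> \<O>" "c2 \<in> \<M>" "d2 \<in> \<O>"
     "a2 \<notin> \<M>" "d2 \<notin> \<M>" using \<open>h' \<in> I\<close> by (rule I_cases)
  have un: "a1 \<noteq> 0" "v a1 = 0" "d1 \<noteq> 0" "v d1 = 0" "a2 \<noteq> 0" "v a2 = 0" "d2 \<noteq> 0" "v d2 = 0"
    using g h unit_iff by blast+
  consider "a = 1" "b = 1" | "a = 2" "b = 2" | "a = 1" "b = 2" | "a = 2" "b = 1"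
    using exhaust_2 by metis
  then show ?thesis
  proof cases
    case 1
    then have "e * a2 = a1 * f" using main by (simp add: Ea Eb g h mat2_eq_iff)
    then have "v (e * a2) = v (a1 * f)" by simp
    then show ?thesis using 1 by (simp add: v_mult un ve \<alpha> \<beta>)
  next
    case 2
    then have "e * d2 = a1 * f" using main by (simp add: Ea Eb g h mat2_eq_iff)
    then have "v (e * d2) = v (a1 * f)" by simp
    then show ?thesis using 2 by (simp add: v_mult un ve \<alpha> \<beta>)
  next
    case 3
    have "e * b2 = a1 * f" "inverse e * c2 = - (d1 * inverse f)"
      using 3 main by (simp_all add: Ea Eb g h mat2_eq_iff)
    then have "f / e = inverse a1 * b2" "e / f = - (inverse d1 * c2)"
      using un by (simp_all add: field_simps)
    then have "f / e \<in> \<O>" "e / f \<in> \<M>"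
      using g h by (auto intro!: O_mult M_mult_right unit_inverse)
    then have "f / e * (e / f) \<in> \<M>" by (rule M_mult_right)
    then show ?thesis by simp
  next
    case 4
    have "e * c2 = a1 * f" "- (inverse e * b2) = d1 * inverse f"
      using 4 main by (simp_all add: Ea Eb g h mat2_eq_iff)
    then have "f / e = inverse a1 * c2" "e / f = - (inverse d1 * b2)"
      using un by (simp_all add: field_simps eq_neg_iff_add_eq_0 neg_eq_iff_add_eq_0)
    then have "f / e \<in> \<M>" "e / f \<in> \<O>"
      using g h by (auto intro!: O_mult M_mult_right unit_inverse)
    then have "f / e * (e / f) \<in> \<M>" by (rule M_mult_left)
    then show ?thesis by simp
  qed
qed

lemma dcoset_disjoint: "x \<in> D \<alpha> \<Longrightarrow> x \<in> D \<beta> \<Longrightarrow> \<alpha> = \<beta>"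
proof -
  assume "x \<in> D \<alpha>" "x \<in> D \<beta>"
  then obtain g h where gh: "g \<in> I" "h \<in> I" "x = g ** E \<alpha> ** h" by (metis dcoset_cases)
  obtain g' where g': "g' \<in> I" "g' ** g = mat 1" using gh(1) by (rule I_inv)
  obtain h' where h': "h' \<in> I" "h ** h' = mat 1" using gh(2) by (rule I_inv)
  have "g' ** x ** h' = (g' ** g) ** E \<alpha> ** (h ** h')"
    by (simp add: gh matrix_mul_assoc)
  then have "g' ** x ** h' = E \<alpha>" by (simp add: g' h')
  moreover have "g' ** x ** h' \<in> D \<beta>" using \<open>x \<in> D \<beta>\<close> g' h' by (simp add: dcoset_left_mult dcoset_right_mult)
  ultimately show "\<alpha> = \<beta>" using eta_rep_in_dcoset_unique by simp
qed

lemma eta_map_eq: "x \<in> D \<alpha> \<Longrightarrow> eta_map v t1 t2 x = E \<alpha>"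
  unfolding eta_map_def using dcoset_disjoint by (intro the_equality) blast+

lemma chi_eq: "chi v t1 t2 \<alpha> x = (if x \<in> D \<alpha> then 1 else 0)"
  by (simp add: chi_def indicator_def)

lemma eta_rep_one: "E (1,0,0) = mat 1"
  by (simp add: mat2_one)

lemma dcoset_one: "D (1,0,0) = I"
proof
  show "D (1,0,0) \<subseteq> I" by (auto simp: dcoset_def eta_rep_one I_mult simp del: eta_rep.simps)
  show "I \<subseteq> D (1,0,0)" using dcosetI[of "mat 1" _ "(1,0,0)"] by (force simp: eta_rep_one simp del: eta_rep.simps)
qed

section \<open>Counting right cosets\<close>

abbreviation "Rc \<equiv> iwahori_rcoset v t1"

lemma rcoset_self: "z \<in> Rc z"
  using I_one unfolding iwahori_rcoset_def by (metis imageI matrix_mul_lid)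

lemma rcoset_sym: assumes "y \<in> Rc z" shows "z \<in> Rc y"
proof -
  obtain h where h: "h \<in> I" "y = h ** z" using assms by (auto simp: iwahori_rcoset_def)
  obtain h' where h': "h' \<in> I" "h' ** h = mat 1" using h(1) by (rule I_inv)
  have "h' ** y = z" using h h' by (simp add: matrix_mul_assoc)
  then show ?thesis using h' by (auto simp: iwahori_rcoset_def)
qed

lemma rcoset_trans: "x \<in> Rc y \<Longrightarrow> y \<in> Rc z \<Longrightarrow> x \<in> Rc z"
  by (auto simp: iwahori_rcoset_def image_iff matrix_mul_assoc) (metis I_mult)

lemma rcoset_eq: "x \<in> Rc y \<Longrightarrow> Rc x = Rc y"
  using rcoset_sym rcoset_trans by blast

lemma rcoset_reps_exist:
  assumes "\<And>h z. h \<in> I \<Longrightarrow> z \<in> S \<Longrightarrow> h ** z \<in> S"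
  shows "\<exists>Z. rcoset_reps v t1 S Z"
proof
  define r where "r C = (SOME y. y \<in> C)" for C :: "('f^2^2) set"
  have r: "r (Rc z) \<in> Rc z" for z
    unfolding r_def using rcoset_self by (rule someI)
  have "S = (\<Union>z\<in>(\<lambda>z. r (Rc z)) ` S. Rc z)"
  proof -
    have "Rc (r (Rc z)) = Rc z" for z using r rcoset_eq by blast
    then have "(\<Union>z\<in>(\<lambda>z. r (Rc z)) ` S. Rc z) = (\<Union>z\<in>S. Rc z)" by simp
    also have "\<dots> = S" using rcoset_self assms by (auto simp: iwahori_rcoset_def)
    finally show ?thesis by simp
  qed
  moreover have "disjoint_family_on Rc ((\<lambda>z. r (Rc z)) ` S)"
    unfolding disjoint_family_on_def
  proof (intro ballI impI equals0I)
    fix m n x assume "m \<in> (\<lambda>z. r (Rc z)) ` S" "n \<in> (\<lambda>z. r (Rc z)) ` S" "m \<noteq> n" "x \<in> Rc m \<inter> Rc n"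
    then obtain y z where yz: "m = r (Rc y)" "n = r (Rc z)" by auto
    have "Rc m = Rc x" "Rc n = Rc x" using \<open>x \<in> Rc m \<inter> Rc n\<close> rcoset_eq by blast+
    moreover have "Rc m = Rc y" "Rc n = Rc z" using r yz rcoset_eq by blast+
    ultimately show False using \<open>m \<noteq> n\<close> yz by simp
  qed
  ultimately show "rcoset_reps v t1 S ((\<lambda>z. r (Rc z)) ` S)"
    by (simp add: rcoset_reps_def)
qed

lemma rcoset_reps_chosen:
  "rcoset_reps v t1 (D \<beta>) (SOME Z. rcoset_reps v t1 (D \<beta>) Z)"
  using rcoset_reps_exist[of "D \<beta>"] dcoset_left_mult by (metis someI_ex)

text \<open>A count over representatives may be replaced by a count over any explicit family that hits
  each right coset in question exactly once. Only the cosets that satisfy \<open>P\<close> have to be listed,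
  which matters because a double coset of nonzero level consists of infinitely many right cosets.\<close>
lemma card_rcoset_reps:
  assumes Z: "rcoset_reps v t1 S Z"
    and P_left: "\<And>h z. h \<in> I \<Longrightarrow> P z \<Longrightarrow> P (h ** z)"
    and f: "\<And>x. x \<in> B \<Longrightarrow> f x \<in> S \<and> P (f x)"
    and cover: "\<And>z. z \<in> S \<Longrightarrow> P z \<Longrightarrow> \<exists>x\<in>B. z \<in> Rc (f x)"
    and inj: "\<And>x y. x \<in> B \<Longrightarrow> y \<in> B \<Longrightarrow> f x \<in> Rc (f y) \<Longrightarrow> x = y"
  shows "card {z \<in> Z. P z} = card B"
proof -
  have P_Rc: "P y" if "y \<in> Rc z" "P z" for y z
    using that P_left by (auto simp: iwahori_rcoset_def)
  have ZS: "Z \<subseteq> S" using Z rcoset_self by (auto simp: rcoset_reps_def)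
  have Z_eq: "z = z'" if "x \<in> Rc z" "x \<in> Rc z'" "z \<in> Z" "z' \<in> Z" for x z z'
    using Z that unfolding rcoset_reps_def disjoint_family_on_def by blast
  have ex: "\<exists>z\<in>Z. f x \<in> Rc z" if "x \<in> B" for x
    using Z f[OF that] by (auto simp: rcoset_reps_def)
  then obtain g where g: "\<And>x. x \<in> B \<Longrightarrow> g x \<in> Z \<and> f x \<in> Rc (g x)" by metis
  have "bij_betw g B {z \<in> Z. P z}"
  proof (rule bij_betwI')
    fix x y assume "x \<in> B" "y \<in> B"
    then show "(g x = g y) = (x = y)" using inj g rcoset_trans rcoset_sym by metis
  next
    fix x assume "x \<in> B" then show "g x \<in> {z \<in> Z. P z}"
      using f g P_Rc rcoset_sym by blast
  next
    fix z assume z: "z \<in> {z \<in> Z. P z}"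
    then obtain x where "x \<in> B" "z \<in> Rc (f x)" using cover ZS by blast
    then show "\<exists>x\<in>B. z = g x" using z g Z_eq rcoset_sym by blast
  qed
  then show ?thesis by (simp add: bij_betw_same_card)
qed

text \<open>The number of right cosets of \<open>I\<close> in the intersection of \<open>C(\<beta>)\<close> with \<open>C(\<alpha>)\<inverse> \<eta>\<^sub>\<gamma>\<close>, a structure
  constant of the convolution before its normalisation by \<open>q\<close>. The condition avoids inverses: it
  says that \<open>\<eta>\<^sub>\<gamma> z\<inverse>\<close> lies in \<open>C(\<alpha>)\<close>.\<close>
definition coset_count where
  "coset_count \<alpha> \<beta> \<gamma> =
     card {z \<in> (SOME Z. rcoset_reps v t1 (D \<beta>) Z). \<exists>y\<in>D \<alpha>. E \<gamma> = y ** z}"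

lemma coset_count_eq:
  assumes f: "\<And>x. x \<in> B \<Longrightarrow> f x \<in> D \<beta> \<and> (\<exists>y\<in>D \<alpha>. E \<gamma> = y ** f x)"
    and cover: "\<And>y z. z \<in> D \<beta> \<Longrightarrow> y \<in> D \<alpha> \<Longrightarrow> E \<gamma> = y ** z \<Longrightarrow> \<exists>x\<in>B. z \<in> Rc (f x)"
    and inj: "\<And>x y. x \<in> B \<Longrightarrow> y \<in> B \<Longrightarrow> f x \<in> Rc (f y) \<Longrightarrow> x = y"
  shows "coset_count \<alpha> \<beta> \<gamma> = card B"
  unfolding coset_count_def
proof (rule card_rcoset_reps)
  show "rcoset_reps v t1 (D \<beta>) (SOME Z. rcoset_reps v t1 (D \<beta>) Z)"
    by (rule rcoset_reps_chosen)
next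
  fix h z assume h: "h \<in> I" and "\<exists>y\<in>D \<alpha>. E \<gamma> = y ** z"
  then obtain y where y: "y \<in> D \<alpha>" "E \<gamma> = y ** z" by blast
  obtain h' where h': "h' \<in> I" "h' ** h = mat 1" using h by (rule I_inv)
  have "y ** h' ** (h ** z) = y ** (h' ** h) ** z" by (simp add: matrix_mul_assoc)
  then have "E \<gamma> = y ** h' ** (h ** z)" using y h' by simp
  then show "\<exists>y\<in>D \<alpha>. E \<gamma> = y ** (h ** z)" using dcoset_right_mult[OF y(1) h'(1)] by blast
qed (use assms in blast)+

lemma fsum_indicator:
  "fsum (\<lambda>z. if P z then 1 else 0 :: complex) Z = of_nat (card {z \<in> Z. P z})"
proof -
  have "{z \<in> Z. (if P z then 1 else 0 :: complex) \<noteq> 0} = {z \<in> Z. P z}" by auto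
  then show ?thesis by (simp add: fsum_def)
qed

lemma chi_conv_eq:
  assumes "0 \<le> snd (snd \<alpha>) * snd (snd \<beta>)" "snd (snd \<gamma>) = snd (snd \<alpha>) + snd (snd \<beta>)" "x \<in> D \<gamma>"
  shows "chi_conv v t1 t2 q \<alpha> \<beta> x = of_nat (coset_count \<alpha> \<beta> \<gamma>) / of_nat q"
proof -
  define Z where "Z = (SOME Z. rcoset_reps v t1 (D \<beta>) Z)"
  have "rcoset_reps v t1 (D \<beta>) Z"
    unfolding Z_def by (rule rcoset_reps_chosen)
  then have ZS: "Z \<subseteq> D \<beta>" using rcoset_self by (auto simp: rcoset_reps_def)
  have lev: "x \<in> level_set v t1 t2 (snd (snd \<alpha>) + snd (snd \<beta>))"
    using assms(2,3) exhaust_2[of "fst \<gamma>"] unfolding level_set_def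
    by (cases \<gamma>) auto
  have "E \<gamma> ** matrix_inv z \<in> D \<alpha> \<longleftrightarrow> (\<exists>y\<in>D \<alpha>. E \<gamma> = y ** z)" if "z \<in> Z" for z
  proof -
    have "z \<in> SL2" using that ZS dcoset_SL2 by blast
    note inv = SL2_inv[OF this]
    show ?thesis
    proof
      assume "E \<gamma> ** matrix_inv z \<in> D \<alpha>"
      moreover have "E \<gamma> = E \<gamma> ** matrix_inv z ** z" by (simp add: inv flip: matrix_mul_assoc)
      ultimately show "\<exists>y\<in>D \<alpha>. E \<gamma> = y ** z" by blast
    next
      assume "\<exists>y\<in>D \<alpha>. E \<gamma> = y ** z"
      then obtain y where "y \<in> D \<alpha>" "E \<gamma> = y ** z" by blast
      then show "E \<gamma> ** matrix_inv z \<in> D \<alpha>" by (simp add: inv flip: matrix_mul_assoc)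
    qed
  qed
  then have "{z \<in> Z. E \<gamma> ** matrix_inv z \<in> D \<alpha>} = {z \<in> Z. \<exists>y\<in>D \<alpha>. E \<gamma> = y ** z}"
    by blast
  then show ?thesis
    using assms(1) lev
    by (simp add: chi_conv_def Let_def eta_map_eq[OF assms(3)] chi_eq fsum_indicator
          coset_count_def Z_def divide_inverse mult.commute)
qed

lemma chi_conv_zero:
  assumes "\<And>\<gamma>. snd (snd \<gamma>) = snd (snd \<alpha>) + snd (snd \<beta>) \<Longrightarrow> x \<notin> D \<gamma>"
  shows "chi_conv v t1 t2 q \<alpha> \<beta> x = 0"
  using assms by (force simp: chi_conv_def Let_def level_set_def)

lemma chi_conv_expansion:
  assumes "0 \<le> snd (snd \<alpha>) * snd (snd \<beta>)" "finite \<Delta>"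
    and level: "\<And>\<delta>. \<delta> \<in> \<Delta> \<Longrightarrow> snd (snd \<delta>) = snd (snd \<alpha>) + snd (snd \<beta>)"
    and count: "\<And>\<gamma>. \<gamma> \<notin> \<Delta> \<Longrightarrow> snd (snd \<gamma>) = snd (snd \<alpha>) + snd (snd \<beta>) \<Longrightarrow> coset_count \<alpha> \<beta> \<gamma> = 0"
  shows "chi_conv v t1 t2 q \<alpha> \<beta> =
    (\<lambda>x. \<Sum>\<delta>\<in>\<Delta>. of_nat (coset_count \<alpha> \<beta> \<delta>) / of_nat q * chi v t1 t2 \<delta> x)"
proof
  fix x
  show "chi_conv v t1 t2 q \<alpha> \<beta> x =
    (\<Sum>\<delta>\<in>\<Delta>. of_nat (coset_count \<alpha> \<beta> \<delta>) / of_nat q * chi v t1 t2 \<delta> x)"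
  proof (cases "\<exists>\<gamma>. snd (snd \<gamma>) = snd (snd \<alpha>) + snd (snd \<beta>) \<and> x \<in> D \<gamma>")
    case True
    then obtain \<gamma> where \<gamma>: "snd (snd \<gamma>) = snd (snd \<alpha>) + snd (snd \<beta>)" "x \<in> D \<gamma>" by blast
    then have "x \<in> D \<delta> \<longleftrightarrow> \<delta> = \<gamma>" for \<delta> using dcoset_disjoint by blast
    then show ?thesis
      using count[OF _ \<gamma>(1)]
      by (simp add: chi_conv_eq[OF assms(1) \<gamma>] chi_eq sum.delta[OF \<open>finite \<Delta>\<close>] if_distrib cong: if_cong)
  next
    case False
    then have "chi_conv v t1 t2 q \<alpha> \<beta> x = 0" by (intro chi_conv_zero) blast
    moreover have "chi v t1 t2 \<delta> x = 0" if "\<delta> \<in> \<Delta>" for \<delta>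
      using False level[OF that] unfolding chi_eq by metis
    ultimately show ?thesis by simp
  qed
qed

lemma chi_conv_single:
  assumes "0 \<le> snd (snd \<alpha>) * snd (snd \<beta>)" "snd (snd \<delta>) = snd (snd \<alpha>) + snd (snd \<beta>)"
    and "\<And>\<gamma>. snd (snd \<gamma>) = snd (snd \<alpha>) + snd (snd \<beta>) \<Longrightarrow>
           coset_count \<alpha> \<beta> \<gamma> = (if \<gamma> = \<delta> then n else 0)"
  shows "chi_conv v t1 t2 q \<alpha> \<beta> = (of_nat n / of_nat q) \<cdot>\<^sub>f chi v t1 t2 \<delta>"
  using chi_conv_expansion[OF assms(1), of "{\<delta>}" q] assms(2,3) by (simp add: fun_scale_def)

section \<open>The product on multiples of characteristic functions\<close>

lemma chi_comb_apply: "x \<in> D \<alpha> \<Longrightarrow> chi_comb v t1 t2 c x = c \<alpha>"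
proof -
  assume "x \<in> D \<alpha>"
  then have "x \<in> D \<beta> \<longleftrightarrow> \<beta> = \<alpha>" for \<beta> using dcoset_disjoint by blast
  then have "{\<beta>. c \<beta> * chi v t1 t2 \<beta> x \<noteq> 0} = (if c \<alpha> = 0 then {} else {\<alpha>})"
    by (auto simp: chi_eq)
  then show ?thesis using \<open>x \<in> D \<alpha>\<close> by (simp add: chi_comb_def fsum_def chi_eq)
qed

lemma chi_comb_outside: "(\<And>\<alpha>. x \<notin> D \<alpha>) \<Longrightarrow> chi_comb v t1 t2 c x = 0"
  by (simp add: chi_comb_def fsum_def chi_eq)

lemma chi_coeff_comb: "chi_coeff v t1 t2 (chi_comb v t1 t2 c) = c"
  unfolding chi_coeff_def
proof (rule the_equality)
  fix c' assume eq: "chi_comb v t1 t2 c = chi_comb v t1 t2 c'"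
  show "c' = c"
  proof
    fix \<alpha> show "c' \<alpha> = c \<alpha>"
      using chi_comb_apply[OF eta_rep_in_dcoset, of c \<alpha>] chi_comb_apply[OF eta_rep_in_dcoset, of c' \<alpha>] eq by simp
  qed
qed simp

lemma scale_chi_eq_comb:
  "c \<cdot>\<^sub>f chi v t1 t2 \<alpha> = chi_comb v t1 t2 (\<lambda>\<beta>. if \<beta> = \<alpha> then c else 0)"
proof
  fix x
  show "(c \<cdot>\<^sub>f chi v t1 t2 \<alpha>) x = chi_comb v t1 t2 (\<lambda>\<beta>. if \<beta> = \<alpha> then c else 0) x"
  proof (cases "\<exists>\<gamma>. x \<in> D \<gamma>")
    case True
    then obtain \<gamma> where \<gamma>: "x \<in> D \<gamma>" by blast
    then have "x \<in> D \<alpha> \<longleftrightarrow> \<gamma> = \<alpha>" using dcoset_disjoint by blast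
    then show ?thesis by (simp add: chi_comb_apply[OF \<gamma>] fun_scale_def chi_eq)
  next
    case False
    then have out: "x \<notin> D \<gamma>" for \<gamma> by blast
    then show ?thesis unfolding chi_comb_outside[OF out] by (simp add: fun_scale_def chi_eq out)
  qed
qed

lemma hecke_mult_chi:
  "hecke_mult v t1 t2 q (c \<cdot>\<^sub>f chi v t1 t2 \<alpha>) (d \<cdot>\<^sub>f chi v t1 t2 \<beta>) =
   (c * d) \<cdot>\<^sub>f chi_conv v t1 t2 q \<alpha> \<beta>"
proof
  fix x
  let ?f = "\<lambda>(\<gamma>, \<delta>). (if \<gamma> = \<alpha> then c else 0) * (if \<delta> = \<beta> then d else 0) * chi_conv v t1 t2 q \<gamma> \<delta> x"
  have "{p. ?f p \<noteq> 0} = (if ?f (\<alpha>, \<beta>) = 0 then {} else {(\<alpha>, \<beta>)})"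
    by (auto split: if_splits)
  then have "fsum ?f UNIV = ?f (\<alpha>, \<beta>)" by (simp add: fsum_def)
  then show "hecke_mult v t1 t2 q (c \<cdot>\<^sub>f chi v t1 t2 \<alpha>) (d \<cdot>\<^sub>f chi v t1 t2 \<beta>) x =
      ((c * d) \<cdot>\<^sub>f chi_conv v t1 t2 q \<alpha> \<beta>) x"
    unfolding hecke_mult_def scale_chi_eq_comb chi_coeff_comb by (simp add: fun_scale_def)
qed

lemma module_fun_scale: "module (fun_scale :: complex \<Rightarrow> ('x \<Rightarrow> complex) \<Rightarrow> _)"
  by (unfold_locales; rule ext; simp add: fun_scale_def algebra_simps)

lemma scale_chi_in_hecke_space: "c \<cdot>\<^sub>f chi v t1 t2 \<alpha> \<in> hecke_space v t1 t2"
proof -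
  obtain a i j where \<alpha>: "\<alpha> = (a, i, j)" by (cases \<alpha>)
  let ?c = "\<lambda>\<beta>. if \<beta> = \<alpha> then c else 0"
  consider "0 < j" | "j < 0" | "j = 0" by linarith
  then have "chi_comb v t1 t2 ?c \<in> hecke_generators v t1 t2"
  proof cases
    case 1
    then have "\<exists>c' a i j. chi_comb v t1 t2 ?c = chi_comb v t1 t2 c' \<and> 0 < j \<and>
        (\<forall>\<beta>. c' \<beta> \<noteq> 0 \<longrightarrow> (\<exists>r\<le>i. \<beta> = (a, r, j)))"
      by (intro exI[of _ ?c] exI[of _ a] exI[of _ i] exI[of _ j]) (simp add: \<alpha>)
    then show ?thesis unfolding hecke_generators_def by (intro UnI1 CollectI)
  next
    case 2
    then have "\<exists>c' a i j. chi_comb v t1 t2 ?c = chi_comb v t1 t2 c' \<and> j < 0 \<and>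
        (\<forall>\<beta>. c' \<beta> \<noteq> 0 \<longrightarrow> (\<exists>r\<ge>i. \<beta> = (a, r, j)))"
      by (intro exI[of _ ?c] exI[of _ a] exI[of _ i] exI[of _ j]) (simp add: \<alpha>)
    then show ?thesis unfolding hecke_generators_def by (intro UnI1 UnI2 CollectI)
  next
    case 3
    then have "\<exists>c' a i i'. chi_comb v t1 t2 ?c = chi_comb v t1 t2 c' \<and>
        (\<forall>\<beta>. c' \<beta> \<noteq> 0 \<longrightarrow> (\<exists>r\<in>{i..i'}. \<beta> = (a, r, 0)))"
      by (intro exI[of _ ?c] exI[of _ a] exI[of _ i] exI[of _ i]) (simp add: \<alpha>)
    then show ?thesis unfolding hecke_generators_def by (intro UnI2 CollectI)
  qed
  then show ?thesis
    unfolding hecke_space_def scale_chi_eq_comb by (rule module.span_base[OF module_fun_scale])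
qed

end

section \<open>Convolution by a simple reflection\<close>

text \<open>The two reflections \<open>s\<^sub>0\<close> and \<open>s\<^sub>1\<close> satisfy the same rank one relations and are treated
  together. Here \<open>s = \<eta>\<^sub>\<sigma>\<close> with inverse \<open>si\<close>, and \<open>u\<close> parametrises the root subgroup \<open>U\<close> of \<open>I\<close> that \<open>s\<close>
  moves out of \<open>I\<close>. The assumptions \<open>I_s\<close> and \<open>s_I\<close> amount to the factorisation of \<open>I\<close> into \<open>U\<close> and the
  part of \<open>I\<close> that \<open>s\<close> normalises; \<open>conj_M\<close> and \<open>conj_unit\<close> describe \<open>s U s\<inverse>\<close>, as in the Bruhat
  decomposition of \<open>SL\<^sub>2\<close> over the residue field.\<close>

locale simple_reflection = rank_two_residue v t1 t2 \<rho>
  for v :: "'f::field \<Rightarrow> int \<times> int" and t1 t2 :: 'f and \<rho> :: "'f \<Rightarrow> 'k::{field,finite}" +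
  fixes \<sigma> :: bruhat_index and si :: "'f^2^2" and u :: "'f \<Rightarrow> 'f^2^2"
  assumes \<sigma>_neq: "\<sigma> \<noteq> (1, 0, 0)" and \<sigma>_level: "snd (snd \<sigma>) = 0"
    and s_inv: "E \<sigma> ** si = mat 1" "si ** E \<sigma> = mat 1"
    and s_square: "E \<sigma> ** E \<sigma> \<in> I"
    and u_I: "x \<in> \<O> \<Longrightarrow> u x \<in> I"
    and u_add: "u (x + y) = u x ** u y"
    and u_zero: "u 0 = mat 1"
    and I_s: "h \<in> I \<Longrightarrow> \<exists>x\<in>\<O>. \<exists>k\<in>I. h ** E \<sigma> = u x ** E \<sigma> ** k"
    and s_I: "h \<in> I \<Longrightarrow> \<exists>x\<in>\<O>. \<exists>k\<in>I. E \<sigma> ** h = k ** E \<sigma> ** u x"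
    and conj_M: "x \<in> \<M> \<Longrightarrow> E \<sigma> ** u x ** si \<in> I"
    and conj_unit: "x \<in> \<O> \<Longrightarrow> x \<notin> \<M> \<Longrightarrow> \<exists>y\<in>\<O>. \<exists>k\<in>I. E \<sigma> ** u x ** si = u y ** E \<sigma> ** k"
begin

abbreviation "s \<equiv> E \<sigma>"

lemma conj_unit_in_D: "x \<in> \<O> \<Longrightarrow> x \<notin> \<M> \<Longrightarrow> s ** u x ** si \<in> D \<sigma>"
  using conj_unit dcosetI u_I by metis

lemma u_inverse: "u x ** u (- x) = mat 1" "u (- x) ** u x = mat 1"
  using u_add[of x "-x"] u_add[of "-x" x] by (simp_all add: u_zero)

lemma dcoset_reflection_disjoint_I: "x \<in> D \<sigma> \<Longrightarrow> x \<notin> I"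
  using dcoset_disjoint[of x \<sigma> "(1,0,0)"] \<sigma>_neq dcoset_one by blast

text \<open>By \<open>s_I\<close> and \<open>conj_M\<close>, the double coset of \<open>s\<close> is the disjoint union of the \<open>q\<close> right cosets
  \<open>I s u(lift k)\<close>.\<close>
lemma coset_count_reflection:
  "coset_count \<alpha> \<sigma> \<gamma> = card {k. \<exists>y\<in>D \<alpha>. E \<gamma> = y ** s ** u (lift k)}"
proof (rule coset_count_eq[where f = "\<lambda>k. s ** u (lift k)"])
  fix k assume "k \<in> {k. \<exists>y\<in>D \<alpha>. E \<gamma> = y ** s ** u (lift k)}"
  then show "s ** u (lift k) \<in> D \<sigma> \<and> (\<exists>y\<in>D \<alpha>. E \<gamma> = y ** (s ** u (lift k)))"
    by (auto simp: matrix_mul_assoc dcoset_right_mult u_I lift)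
next
  fix y z assume yz: "z \<in> D \<sigma>" "y \<in> D \<alpha>" "E \<gamma> = y ** z"
  then obtain g h where gh: "g \<in> I" "h \<in> I" "z = g ** s ** h" by (metis dcoset_cases)
  obtain x k where xk: "x \<in> \<O>" "k \<in> I" "s ** h = k ** s ** u x" using s_I[OF gh(2)] by blast
  define l where "l = lift (\<rho> x)"
  have l: "l \<in> \<O>" "x - l \<in> \<M>" using lift_residue[OF xk(1)] by (auto simp: l_def lift)
  have "u x = u (x - l) ** u l" by (simp flip: u_add)
  then have "s ** u x = s ** u (x - l) ** (si ** s) ** u l" by (simp add: s_inv matrix_mul_assoc)
  then have "s ** u x = (s ** u (x - l) ** si) ** (s ** u l)" by (simp only: matrix_mul_assoc)
  then have "z = (g ** k ** (s ** u (x - l) ** si)) ** (s ** u l)"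
    using xk gh by (metis matrix_mul_assoc)
  moreover have h: "g ** k ** (s ** u (x - l) ** si) \<in> I"
    using gh xk conj_M[OF l(2)] by (simp add: I_mult)
  ultimately obtain h where h: "h \<in> I" "z = h ** (s ** u l)" by blast
  then have "z \<in> Rc (s ** u l)" by (auto simp: iwahori_rcoset_def)
  moreover have "E \<gamma> = (y ** h) ** s ** u l" using yz h by (simp add: matrix_mul_assoc)
  then have "\<rho> x \<in> {k. \<exists>y\<in>D \<alpha>. E \<gamma> = y ** s ** u (lift k)}"
    using dcoset_right_mult[OF yz(2) h(1)] l_def by blast
  ultimately show "\<exists>k\<in>{k. \<exists>y\<in>D \<alpha>. E \<gamma> = y ** s ** u (lift k)}. z \<in> Rc (s ** u (lift k))"
    using l_def by blast
next
  fix k l assume "s ** u (lift k) \<in> Rc (s ** u (lift l))"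
  then obtain h where h: "h \<in> I" "s ** u (lift k) = h ** (s ** u (lift l))"
    by (auto simp: iwahori_rcoset_def)
  have "s ** u (lift k - lift l) ** si = (s ** u (lift k)) ** u (- lift l) ** si"
    using u_add[of "lift k" "- lift l"] by (simp add: matrix_mul_assoc)
  also have "\<dots> = h ** (s ** (u (lift l) ** u (- lift l)) ** si)"
    by (simp add: h matrix_mul_assoc)
  also have "\<dots> = h" by (simp add: u_inverse s_inv)
  finally have "s ** u (lift k - lift l) ** si \<in> I" using h by simp
  then have "lift k - lift l \<in> \<M>" using conj_unit_in_D dcoset_reflection_disjoint_I O_diff lift by blast
  then show "k = l" by (simp add: lift_diff_M)
qed

text \<open>If \<open>\<eta>\<^sub>\<alpha> U \<eta>\<^sub>\<alpha>\<inverse>\<close> lies in \<open>I\<close>, then \<open>I \<eta>\<^sub>\<alpha> I s I = I \<eta>\<^sub>\<alpha> U s I = I \<eta>\<^sub>\<alpha> s I\<close>, so only \<open>\<delta>\<close> can carry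
  the product. The coset of \<open>s u(x)\<close> with \<open>x\<close> a unit does not contribute at \<open>\<delta>\<close>: as \<open>s u(-x) s\<inverse>\<close> lies in
  \<open>U s I\<close>, the element \<open>\<eta>\<^sub>\<delta> (s u(x))\<inverse>\<close> lies in \<open>I \<eta>\<^sub>\<alpha> U s I = C(\<delta>)\<close> and not in \<open>C(\<alpha>)\<close>. The factor \<open>c\<close> absorbs the sign in
  relations such as \<open>s\<^sub>0 s\<^sub>1 = - \<eta>(1,1,0)\<close>.\<close>
lemma conv_length_additive:
  assumes \<delta>: "c \<in> I" "E \<delta> = c ** E \<alpha> ** s" "\<delta> \<noteq> \<alpha>" "snd (snd \<delta>) = snd (snd \<alpha>)"
    and U: "\<And>x. x \<in> \<O> \<Longrightarrow> \<exists>k\<in>I. E \<alpha> ** u x = k ** E \<alpha>"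
  shows "chi_conv v t1 t2 q \<alpha> \<sigma> = (1 / of_nat q) \<cdot>\<^sub>f chi v t1 t2 \<delta>"
proof -
  have \<alpha>s: "E \<alpha> ** s \<in> D \<delta>"
  proof -
    obtain c' where c': "c' \<in> I" "c' ** c = mat 1" using \<delta>(1) by (rule I_inv)
    have "E \<alpha> ** s = c' ** E \<delta>" using c' by (simp add: \<delta>(2) matrix_mul_assoc)
    then show ?thesis using dcoset_left_mult[OF eta_rep_in_dcoset c'(1)] by simp
  qed
  have D\<alpha>s: "y ** s \<in> D \<delta>" if y: "y \<in> D \<alpha>" for y
  proof -
    obtain g h where gh: "g \<in> I" "h \<in> I" "y = g ** E \<alpha> ** h" using y by (rule dcoset_cases)
    obtain x k where xk: "x \<in> \<O>" "k \<in> I" "h ** s = u x ** s ** k" using I_s[OF gh(2)] by blast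
    obtain k' where k': "k' \<in> I" "E \<alpha> ** u x = k' ** E \<alpha>" using U[OF xk(1)] by blast
    have "y ** s = g ** E \<alpha> ** (h ** s)" by (simp add: gh matrix_mul_assoc)
    also have "\<dots> = g ** (E \<alpha> ** u x) ** s ** k" by (simp add: xk matrix_mul_assoc)
    also have "\<dots> = (g ** k') ** (E \<alpha> ** s) ** k" by (simp add: k' matrix_mul_assoc)
    finally show ?thesis using \<alpha>s gh xk k' by (simp add: dcoset_left_mult dcoset_right_mult I_mult)
  qed
  \<comment> \<open>\<open>C(\<alpha>) s U\<close> lies in \<open>C(\<delta>)\<close>, which contains no other representative.\<close>
  have other: "coset_count \<alpha> \<sigma> \<gamma> = 0" if "\<gamma> \<noteq> \<delta>" for \<gamma>
  proof -
    have "E \<gamma> \<noteq> y ** s ** u (lift k)" if "y \<in> D \<alpha>" for y k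
      using dcoset_right_mult[OF D\<alpha>s[OF that] u_I[OF lift(1)[of k]]] \<open>\<gamma> \<noteq> \<delta>\<close> eta_rep_in_dcoset_unique by metis
    then show ?thesis by (simp add: coset_count_reflection)
  qed
  \<comment> \<open>At \<open>\<delta>\<close> exactly the coset of \<open>s\<close> itself contributes.\<close>
  have "{k. \<exists>y\<in>D \<alpha>. E \<delta> = y ** s ** u (lift k)} = {0}"
  proof (intro set_eqI iffI)
    fix k assume "k \<in> {0::'k}"
    then have M: "- lift k \<in> \<M>" by (simp add: lift_M)
    define y where "y = c ** E \<alpha> ** (s ** u (- lift k) ** si)"
    have "y \<in> D \<alpha>" unfolding y_def using \<delta>(1) conj_M[OF M] by (intro dcosetI)
    moreover have "y ** s ** u (lift k) = c ** E \<alpha> ** s ** u (- lift k) ** (si ** s) ** u (lift k)"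
      by (simp only: y_def matrix_mul_assoc)
    then have "y ** s ** u (lift k) = c ** E \<alpha> ** s"
      by (simp add: s_inv u_inverse flip: matrix_mul_assoc)
    ultimately have "y \<in> D \<alpha>" "E \<delta> = y ** s ** u (lift k)" using \<delta>(2) by simp_all
    then show "k \<in> {k. \<exists>y\<in>D \<alpha>. E \<delta> = y ** s ** u (lift k)}" by blast
  next
    fix k assume "k \<in> {k. \<exists>y\<in>D \<alpha>. E \<delta> = y ** s ** u (lift k)}"
    then obtain y where y: "y \<in> D \<alpha>" "E \<delta> = y ** s ** u (lift k)" by blast
    show "k \<in> {0}"
    proof (rule ccontr)
      assume "k \<notin> {0}"
      then have "- lift k \<in> \<O>" "- lift k \<notin> \<M>" by (simp_all add: lift lift_M)
      then obtain x h where xh: "x \<in> \<O>" "h \<in> I" "s ** u (- lift k) ** si = u x ** s ** h"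
        using conj_unit by blast
      obtain k' where k': "k' \<in> I" "E \<alpha> ** u x = k' ** E \<alpha>" using U[OF xh(1)] by blast
      have "y = y ** (s ** (u (lift k) ** u (- lift k)) ** si)" by (simp add: u_inverse s_inv)
      also have "\<dots> = E \<delta> ** u (- lift k) ** si" by (simp add: y matrix_mul_assoc)
      also have "\<dots> = c ** E \<alpha> ** (s ** u (- lift k) ** si)" by (simp add: \<delta>(2) matrix_mul_assoc)
      also have "\<dots> = c ** (E \<alpha> ** u x) ** s ** h" by (simp add: xh matrix_mul_assoc)
      also have "\<dots> = (c ** k') ** (E \<alpha> ** s) ** h" by (simp add: k' matrix_mul_assoc)
      finally have "y \<in> D \<delta>" using \<alpha>s \<delta>(1) xh k' by (simp add: dcoset_left_mult dcoset_right_mult I_mult)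
      then show False using y(1) dcoset_disjoint \<delta>(3) by blast
    qed
  qed
  then have "coset_count \<alpha> \<sigma> \<delta> = 1" by (simp add: coset_count_reflection)
  then show ?thesis
    using chi_conv_single[of \<alpha> \<sigma> \<delta> 1 q] other \<delta>(4) \<sigma>_level by simp
qed

lemma si_eq: obtains h where "h \<in> I" "si = s ** h"
proof -
  obtain h where h: "h \<in> I" "s ** s ** h = mat 1" using s_square by (rule I_inv)
  have "si ** s ** s ** h = si" using h by (simp flip: matrix_mul_assoc)
  then have "si = s ** h" by (simp add: s_inv)
  then show thesis using h that by blast
qed

text \<open>The product is carried by \<open>I s I s I\<close>, which is contained in \<open>I s U s I\<close> and so in the union of
  \<open>I\<close> and \<open>I s I\<close>. At \<open>1\<close> all \<open>q\<close> cosets contribute, since \<open>s\<inverse>\<close> lies in \<open>C(s)\<close>; at \<open>s\<close> the condition is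
  that \<open>s u(-x) s\<inverse>\<close> lies in \<open>C(s)\<close>, which excludes precisely the coset with \<open>x\<close> in \<open>\<M>\<close>.\<close>
lemma conv_quadratic:
  assumes "q = CARD('k)"
  shows "chi_conv v t1 t2 q \<sigma> \<sigma> =
    chi v t1 t2 (1,0,0) + ((of_nat q - 1) / of_nat q) \<cdot>\<^sub>f chi v t1 t2 \<sigma>"
proof -
  have si_D: "si \<in> D \<sigma>" using si_eq eta_rep_in_dcoset dcoset_right_mult by metis
  have other: "coset_count \<sigma> \<sigma> \<gamma> = 0" if \<gamma>: "\<gamma> \<notin> {(1,0,0), \<sigma>}" for \<gamma>
  proof -
    have False if y: "y \<in> D \<sigma>" "E \<gamma> = y ** s ** u (lift k)" for y k
    proof -
      obtain g h where gh: "g \<in> I" "h \<in> I" "y = g ** s ** h" using y(1) by (rule dcoset_cases)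
      obtain x k' where x: "x \<in> \<O>" "k' \<in> I" "h ** s = u x ** s ** k'" using I_s[OF gh(2)] by blast
      have "y ** s ** u (lift k) = g ** s ** (h ** s) ** u (lift k)" by (simp add: gh matrix_mul_assoc)
      also have "\<dots> = g ** (s ** u x) ** s ** k' ** u (lift k)" by (simp add: x matrix_mul_assoc)
      also have "\<dots> = g ** (s ** u x) ** (si ** s) ** s ** k' ** u (lift k)"
        by (simp add: s_inv)
      also have "\<dots> = g ** (s ** u x ** si) ** ((s ** s) ** k' ** u (lift k))"
        by (simp only: matrix_mul_assoc)
      finally have eq: "E \<gamma> = g ** (s ** u x ** si) ** ((s ** s) ** k' ** u (lift k))"
        using y(2) by simp
      have h: "(s ** s) ** k' ** u (lift k) \<in> I" using x s_square by (simp add: I_mult u_I lift)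
      have "s ** u x ** si \<in> D (1,0,0) \<or> s ** u x ** si \<in> D \<sigma>"
        using conj_M conj_unit_in_D x(1) dcoset_one by blast
      then have "E \<gamma> \<in> D (1,0,0) \<or> E \<gamma> \<in> D \<sigma>"
        unfolding eq using gh(1) h dcoset_left_mult dcoset_right_mult by blast
      then show False using \<gamma> eta_rep_in_dcoset_unique by blast
    qed
    then show ?thesis by (auto simp: coset_count_reflection)
  qed
  have one: "coset_count \<sigma> \<sigma> (1,0,0) = q"
  proof -
    have "mat 1 = (u (- lift k) ** si) ** s ** u (lift k)" for k
    proof -
      have "(u (- lift k) ** si) ** s ** u (lift k) = u (- lift k) ** (si ** s) ** u (lift k)"
        by (simp only: matrix_mul_assoc)
      then show ?thesis by (simp add: s_inv u_inverse)
    qed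
    moreover have "u (- lift k) ** si \<in> D \<sigma>" for k using si_D by (simp add: dcoset_left_mult u_I lift)
    ultimately have "{k. \<exists>y\<in>D \<sigma>. E (1,0,0) = y ** s ** u (lift k)} = UNIV"
      unfolding eta_rep_one by blast
    then show ?thesis by (simp add: coset_count_reflection assms)
  qed
  have self: "coset_count \<sigma> \<sigma> \<sigma> = q - 1"
  proof -
    have "(\<exists>y\<in>D \<sigma>. s = y ** s ** u (lift k)) \<longleftrightarrow> k \<noteq> 0" for k
    proof
      assume "\<exists>y\<in>D \<sigma>. s = y ** s ** u (lift k)"
      then obtain y where y: "y \<in> D \<sigma>" "s = y ** s ** u (lift k)" by blast
      have "y = y ** (s ** (u (lift k) ** u (- lift k)) ** si)" by (simp add: u_inverse s_inv)
      also have "\<dots> = (y ** s ** u (lift k)) ** u (- lift k) ** si" by (simp add: matrix_mul_assoc)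
      also have "\<dots> = s ** u (- lift k) ** si" by (simp flip: y(2))
      finally have "s ** u (- lift k) ** si \<notin> I" using y(1) dcoset_reflection_disjoint_I by simp
      then show "k \<noteq> 0" using conj_M[of "- lift k"] by (auto simp: lift_M)
    next
      assume "k \<noteq> 0"
      then have "s ** u (- lift k) ** si \<in> D \<sigma>" by (intro conj_unit_in_D) (simp_all add: lift lift_M)
      moreover have "s = (s ** u (- lift k) ** si) ** s ** u (lift k)"
      proof -
        have "(s ** u (- lift k) ** si) ** s ** u (lift k) = s ** (u (- lift k) ** (si ** s) ** u (lift k))"
          by (simp only: matrix_mul_assoc)
        then show ?thesis by (simp add: s_inv u_inverse)
      qed
      ultimately show "\<exists>y\<in>D \<sigma>. s = y ** s ** u (lift k)" by blast
    qed
    then have "{k. \<exists>y\<in>D \<sigma>. s = y ** s ** u (lift k)} = UNIV - {0}" by auto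
    then show ?thesis by (simp add: coset_count_reflection assms card_Diff_singleton)
  qed
  have q: "q \<ge> 1" using assms by (simp add: Suc_leI)
  have "chi_conv v t1 t2 q \<sigma> \<sigma> = (\<lambda>x. \<Sum>\<delta>\<in>{(1,0,0), \<sigma>}.
      of_nat (coset_count \<sigma> \<sigma> \<delta>) / of_nat q * chi v t1 t2 \<delta> x)"
    using other \<sigma>_level by (intro chi_conv_expansion) auto
  then show ?thesis
    using q \<sigma>_neq by (simp add: one self fun_scale_def fun_eq_iff of_nat_diff)
qed

end

section \<open>The two simple reflections\<close>

context rank_two_residue
begin

definition "upper x = mat2 1 x 0 1" for x :: 'f

text \<open>The factor \<open>t1\<close> lets \<open>\<O>\<close> parametrise both root subgroups of \<open>I\<close>.\<close>
definition "lower x = mat2 1 0 (t1 * x) 1" for x :: 'f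

text \<open>All factors below come from solving for the unipotent part: \<open>b / d\<close> and \<open>b / a\<close> clear the upper
  right entry of \<open>h\<close>, and \<open>u(-1/x)\<close> is the left unipotent factor in the Bruhat decomposition of the
  lower unipotent matrix \<open>s u(x) s\<inverse>\<close>.\<close>
sublocale finite_reflection: simple_reflection v t1 t2 \<rho> "(2,0,0)" "mat2 0 (-1) 1 0" upper
proof
  fix h assume "h \<in> I"
  then obtain a b c d where h: "h = mat2 a b c d" "a \<in> \<O>" "b \<in> \<O>" "c \<in> \<M>" "d \<in> \<O>"
     "a * d - b * c = 1" "a \<notin> \<M>" "d \<notin> \<M>" by (rule I_cases)
  then have [simp]: "a \<noteq> 0" "d \<noteq> 0" by auto
  have det: "a * d = 1 + b * c" using h(6) by (simp add: algebra_simps)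
  show "\<exists>x\<in>\<O>. \<exists>k\<in>I. h ** E (2,0,0) = upper x ** E (2,0,0) ** k"
  proof (intro bexI)
    show "h ** E (2,0,0) = upper (b / d) ** E (2,0,0) ** mat2 d (- c) 0 (1 / d)"
      using det by (simp add: h upper_def mat2_eq_iff field_simps)
  qed (use h unit_divide in \<open>simp_all add: mat2_in_iwahori M_imp_O\<close>)
  show "\<exists>x\<in>\<O>. \<exists>k\<in>I. E (2,0,0) ** h = k ** E (2,0,0) ** upper x"
  proof (intro bexI)
    show "E (2,0,0) ** h = mat2 (1 / a) (- c) 0 a ** E (2,0,0) ** upper (b / a)"
      using det by (simp add: h upper_def mat2_eq_iff field_simps)
  qed (use h unit_divide in \<open>simp_all add: mat2_in_iwahori M_imp_O\<close>)
next
  fix x assume x: "x \<in> \<O>" "x \<notin> \<M>"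
  then have [simp]: "x \<noteq> 0" by auto
  show "\<exists>y\<in>\<O>. \<exists>k\<in>I. E (2,0,0) ** upper x ** mat2 0 (-1) 1 0 = upper y ** E (2,0,0) ** k"
  proof (intro bexI)
    show "E (2,0,0) ** upper x ** mat2 0 (-1) 1 0 =
      upper (- (1 / x)) ** E (2,0,0) ** mat2 x (-1) 0 (1 / x)"
      by (simp add: upper_def mat2_eq_iff)
  qed (use x unit_divide[of x 1] in \<open>simp_all add: mat2_in_iwahori\<close>)
qed (auto simp: upper_def mat2_in_iwahori add.commute simp flip: mat2_one)

text \<open>Conjugation by the antidiagonal matrix with entries \<open>1\<close> and \<open>t1\<close> normalises \<open>I\<close> and exchanges the
  two reflections up to sign, so the factors are those of the other case with upper and lower triangular
  matrices exchanged.\<close>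
sublocale affine_reflection: simple_reflection v t1 t2 \<rho> "(2,-1,0)" "mat2 0 (- inverse t1) t1 0" lower
proof
  fix h assume "h \<in> I"
  then obtain a b c d where h: "h = mat2 a b c d" "a \<in> \<O>" "b \<in> \<O>" "c \<in> \<M>" "d \<in> \<O>"
     "a * d - b * c = 1" "a \<notin> \<M>" "d \<notin> \<M>" by (rule I_cases)
  then have [simp]: "a \<noteq> 0" "d \<noteq> 0" by auto
  have det: "a * d = 1 + b * c" using h(6) by (simp add: algebra_simps)
  have det': "t1 + b * (c * t1) = a * (d * t1)"
  proof -
    have "t1 + b * (c * t1) = (1 + b * c) * t1" by (simp add: algebra_simps)
    then show ?thesis by (simp only: det[symmetric] mult.assoc)
  qed
  have c: "c / t1 \<in> \<O>" using h by (simp add: divide_t1)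
  have quot: "c / (t1 * a) \<in> \<O>" "c / (t1 * d) \<in> \<O>"
    using unit_divide[OF _ _ c] h by (metis divide_divide_eq_left)+
  have M: "- (b * t1 * t1) \<in> \<M>" using h t1_M by (simp add: M_mult_right O_mult M_imp_O)
  show "\<exists>x\<in>\<O>. \<exists>k\<in>I. h ** E (2,-1,0) = lower x ** E (2,-1,0) ** k"
  proof (intro bexI)
    show "h ** E (2,-1,0) = lower (c / t1 / a) ** E (2,-1,0) ** mat2 (1 / a) 0 (- (b * t1 * t1)) a"
      using det by (auto simp: h lower_def mat2_eq_iff field_simps intro: det' det'[symmetric])
  qed (use h c M quot unit_divide in \<open>simp_all add: mat2_in_iwahori\<close>)
  show "\<exists>x\<in>\<O>. \<exists>k\<in>I. E (2,-1,0) ** h = k ** E (2,-1,0) ** lower x"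
  proof (intro bexI)
    show "E (2,-1,0) ** h = mat2 d 0 (- (b * t1 * t1)) (1 / d) ** E (2,-1,0) ** lower (c / t1 / d)"
      using det by (auto simp: h lower_def mat2_eq_iff field_simps intro: det' det'[symmetric])
  qed (use h c M quot unit_divide in \<open>simp_all add: mat2_in_iwahori\<close>)
next
  fix x assume x: "x \<in> \<O>" "x \<notin> \<M>"
  then have [simp]: "x \<noteq> 0" by auto
  show "\<exists>y\<in>\<O>. \<exists>k\<in>I. E (2,-1,0) ** lower x ** mat2 0 (- inverse t1) t1 0 = lower y ** E (2,-1,0) ** k"
  proof (intro bexI)
    show "E (2,-1,0) ** lower x ** mat2 0 (- inverse t1) t1 0 =
      lower (- (1 / x)) ** E (2,-1,0) ** mat2 (- (1 / x)) 0 t1 (- x)"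
      by (simp add: lower_def mat2_eq_iff field_simps)
  qed (use x unit_divide[of x 1] t1_M in \<open>simp_all add: mat2_in_iwahori\<close>)
next
  fix x assume "x \<in> \<M>"
  then have "inverse t1 * (t1 * x) * inverse t1 \<in> \<O>" using divide_t1[of x] by (simp add: field_simps)
  then show "E (2,-1,0) ** lower x ** mat2 0 (- inverse t1) t1 0 \<in> I"
    by (simp add: lower_def mat2_in_iwahori)
qed (auto simp: lower_def mat2_in_iwahori M_eq_t1_O distrib_left add.commute simp flip: mat2_one)

section \<open>Convolution by a translation on negative levels\<close>

lemma translation_eta_rep:
  "mat2 (1 / t1) 0 0 t1 ** E (a, i, j) = E (a, i - 1, j)"
  by (simp add: power_int_diff power_int_add power_int_minus mat2_eq_iff divide_simps)

text \<open>Up to sign, conjugation by \<open>\<eta>\<inverse>\<close> with parameter \<open>e = t1\<^sup>i t2\<^sup>j\<close> multiplies the off-diagonal entry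
  by \<open>e\<^sup>-\<^sup>2\<close>. For \<open>j < 0\<close> the valuation of \<open>e\<^sup>-\<^sup>2\<close> exceeds that of every power of \<open>t1\<close>, so the result
  falls into \<open>\<M>\<close> uniformly in \<open>i\<close>.\<close>
lemma upper_absorbed:
  assumes "x \<in> \<O>" "j < 0"
  shows "\<exists>k\<in>I. upper x ** E (a, i, j) = E (a, i, j) ** k"
proof -
  define e where "e = t1 powi i * t2 powi j"
  have e: "e \<noteq> 0" "v e = (i, j)" by (auto simp: e_def v_param)
  have shape: "E (a, i, j) = (if a = 1 then mat2 e 0 0 (inverse e) else mat2 0 e (- inverse e) 0)"
    by (simp add: e_def power_int_minus)
  have M: "x / (e * e) \<in> \<M>"
  proof (cases "x = 0")
    case False
    then have "v (x / (e * e)) = v x - (v e + v e)"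
      using e by (simp add: divide_inverse v_mult v_inverse)
    then show ?thesis using assms e by (auto simp: M_iff O_iff)
  qed simp
  consider "a = 1" | "a = 2" using exhaust_2 by blast
  then show ?thesis
  proof cases
    case 1
    have "upper x ** E (a, i, j) = E (a, i, j) ** mat2 1 (x / (e * e)) 0 1"
      unfolding shape using e(1) 1 by (simp add: upper_def mat2_eq_iff field_simps)
    moreover have "mat2 1 (x / (e * e)) 0 1 \<in> I" using M by (simp add: mat2_in_iwahori M_imp_O)
    ultimately show ?thesis by blast
  next
    case 2
    have "upper x ** E (a, i, j) = E (a, i, j) ** mat2 1 0 (- (x / (e * e))) 1"
      unfolding shape using e(1) 2 by (simp add: upper_def mat2_eq_iff field_simps)
    moreover have "mat2 1 0 (- (x / (e * e))) 1 \<in> I" using M by (simp add: mat2_in_iwahori)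
    ultimately show ?thesis by blast
  qed
qed

text \<open>The double coset of \<open>\<eta>(1,1,0)\<close> is finite over \<open>I\<close>, whereas that of \<open>(a,i,j)\<close> is infinite, so the
  cosets are listed from the side of the translation. With \<open>T = \<eta>(1,1,0)\<inverse>\<close>, the inverse double coset
  is the disjoint union of the \<open>I T upper(x)\<close>, where \<open>x\<close> runs over the \<open>q\<^sup>2\<close> residues of \<open>\<O>\<close> modulo
  \<open>t1\<^sup>2\<close>. Applied to \<open>\<eta>(b,m,j)\<close>, the unipotent factor is absorbed on the right, and all of these cosets
  land in \<open>C(b,m-1,j)\<close>: either all or none of them lie in \<open>C(a,i,j)\<close>.\<close>
lemma conv_translation:
  assumes "q = CARD('k)" "j < 0"
  shows "chi_conv v t1 t2 q (1,1,0) (a,i,j) = of_nat q \<cdot>\<^sub>f chi v t1 t2 (a,i+1,j)"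
proof -
  let ?\<alpha> = "(1,1,0) :: bruhat_index"
  define T where "T = mat2 (1 / t1) 0 0 t1"
  have T: "E ?\<alpha> ** T = mat 1" "T ** E ?\<alpha> = mat 1"
    by (simp_all add: T_def flip: mat2_one)
  have TE: "T ** E (b, m, l) = E (b, m - 1, l)" for b m l
    unfolding T_def by (rule translation_eta_rep)
  have shape: "T ** upper x ** E (b, m, j) \<in> D (b, m - 1, j)" if x: "x \<in> \<O>" for x b m
  proof -
    obtain k where k: "k \<in> I" "upper x ** E (b, m, j) = E (b, m, j) ** k"
      using upper_absorbed[OF x assms(2)] by blast
    have "T ** upper x ** E (b, m, j) = T ** E (b, m, j) ** k"
      by (simp only: k flip: matrix_mul_assoc)
    then show ?thesis unfolding TE using k(1) by (simp only: dcoset_right_mult eta_rep_in_dcoset)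
  qed
  \<comment> \<open>Representatives of \<open>\<O>\<close> modulo \<open>t1\<^sup>2\<close>, by their two leading digits.\<close>
  define r where "r p = lift (fst p) + t1 * lift (snd p)" for p :: "'k \<times> 'k"
  have rO: "r p \<in> \<O>" for p
    unfolding r_def using lift t1_M by (simp add: O_add O_mult M_imp_O)
  have T_upper: "T ** upper (t1 * t1 * x) = upper x ** T" for x
    by (simp add: T_def upper_def mat2_eq_iff)
  have decompose: "\<exists>k\<in>I. \<exists>p. T ** h = k ** T ** upper (r p)" if hI: "h \<in> I" for h
  proof -
    obtain a b c d where h: "h = mat2 a b c d" "a \<in> \<O>" "b \<in> \<O>" "c \<in> \<M>" "d \<in> \<O>"
      "a * d - b * c = 1" "a \<notin> \<M>" "d \<notin> \<M>" using hI by (rule I_cases)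
    then have [simp]: "a \<noteq> 0" by auto
    define x where "x = b / a"
    have x: "x \<in> \<O>" unfolding x_def using h unit_divide by blast
    define y where "y = (x - lift (\<rho> x)) / t1"
    have y: "y \<in> \<O>" unfolding y_def divide_t1 using lift_residue[OF x] .
    define z where "z = (y - lift (\<rho> y)) / t1"
    have z: "z \<in> \<O>" unfolding z_def divide_t1 using lift_residue[OF y] .
    define p where "p = (\<rho> x, \<rho> y)"
    have "x = t1 * t1 * z + r p" by (simp add: r_def p_def z_def y_def field_simps)
    then have ux: "upper x = upper (t1 * t1 * z) ** upper (r p)"
      by (simp add: upper_def mat2_eq_iff)
    \<comment> \<open>\<open>g\<close> is \<open>T h upper(-x) T\<inverse>\<close>; the conjugated matrix is lower triangular by the choice of \<open>x\<close>.\<close>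
    define g where "g = mat2 a 0 (c * (t1 * t1)) (1 / a)"
    have "c * (t1 * t1) \<in> \<M>" using h t1_M by (simp add: M_mult_left O_mult M_imp_O)
    then have gI: "g \<in> I" unfolding g_def using h unit_divide[of a 1] by (simp add: mat2_in_iwahori)
    have det: "a * d = 1 + b * c" using h(6) by (simp add: algebra_simps)
    have "a * (d * t1) = (1 + b * c) * t1" by (simp only: det[symmetric] mult.assoc)
    then have "a * (d * t1) = t1 + b * (c * t1)" by (simp add: algebra_simps)
    then have "T ** h = g ** T ** upper x"
      using det by (simp add: h T_def g_def x_def upper_def mat2_eq_iff field_simps)
    also have "\<dots> = g ** (T ** upper (t1 * t1 * z)) ** upper (r p)"
      by (simp add: ux matrix_mul_assoc)
    also have "\<dots> = (g ** upper z) ** T ** upper (r p)"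
      by (simp add: T_upper matrix_mul_assoc)
    finally show ?thesis using I_mult[OF gI finite_reflection.u_I[OF z]] by blast
  qed
  have count: "coset_count ?\<alpha> (a,i,j) (b,m,j) = (if (b,m,j) = (a,i+1,j) then q * q else 0)" for b m
  proof -
    let ?f = "\<lambda>p. T ** upper (r p) ** E (b, m, j)"
    define B where "B = (if (b,m,j) = (a,i+1,j) then (UNIV :: ('k \<times> 'k) set) else {})"
    have "coset_count ?\<alpha> (a,i,j) (b,m,j) = card B"
    proof (rule coset_count_eq[where f = ?f])
      fix p assume "p \<in> B"
      then have eq: "b = a" "m = i + 1" by (auto simp: B_def split: if_splits)
      have "?f p \<in> D (a, i, j)" using shape[OF rO, of p b m] by (simp add: eq)
      moreover have "upper (- r p) ** E ?\<alpha> \<in> D ?\<alpha>"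
        using rO[of p] by (intro dcoset_left_mult eta_rep_in_dcoset finite_reflection.u_I) simp
      moreover have "E (b,m,j) = upper (- r p) ** E ?\<alpha> ** ?f p"
      proof -
        have "upper (- r p) ** E ?\<alpha> ** ?f p = upper (- r p) ** (E ?\<alpha> ** T) ** upper (r p) ** E (b,m,j)"
          by (simp only: matrix_mul_assoc)
        then show ?thesis by (simp only: T matrix_mul_rid finite_reflection.u_inverse matrix_mul_lid)
      qed
      ultimately show "?f p \<in> D (a, i, j) \<and> (\<exists>y\<in>D ?\<alpha>. E (b,m,j) = y ** ?f p)" by blast
    next
      fix y z assume yz: "z \<in> D (a,i,j)" "y \<in> D ?\<alpha>" "E (b,m,j) = y ** z"
      obtain g h where gh: "g \<in> I" "h \<in> I" "y = g ** E ?\<alpha> ** h" using yz(2) by (rule dcoset_cases)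
      obtain g' where g': "g' \<in> I" "g' ** g = mat 1" using gh(1) by (rule I_inv)
      obtain h' where h': "h' \<in> I" "h' ** h = mat 1" using gh(2) by (rule I_inv)
      obtain k p where kp: "k \<in> I" "T ** g' = k ** T ** upper (r p)" using decompose[OF g'(1)] by blast
      have "h' ** (T ** g') ** E (b,m,j) = h' ** (T ** ((g' ** g) ** E ?\<alpha>)) ** h ** z"
        by (simp only: yz(3) gh matrix_mul_assoc)
      also have "\<dots> = (h' ** h) ** z" by (simp only: g' matrix_mul_lid T matrix_mul_rid)
      also have "\<dots> = z" by (simp only: h' matrix_mul_lid)
      finally have "z = (h' ** k) ** ?f p" by (simp only: kp matrix_mul_assoc)
      moreover have hk: "h' ** k \<in> I" using h' kp by (simp add: I_mult)
      ultimately have zR: "z \<in> Rc (?f p)" by (auto simp: iwahori_rcoset_def)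
      have "z \<in> D (b, m - 1, j)"
        using dcoset_left_mult[OF shape[OF rO[of p], of b m] hk] \<open>z = (h' ** k) ** ?f p\<close> by simp
      then have "(b, m - 1, j) = (a, i, j)" using yz(1) dcoset_disjoint by blast
      then have "p \<in> B" by (auto simp: B_def)
      then show "\<exists>p\<in>B. z \<in> Rc (?f p)" using zR by blast
    next
      fix p p' assume "?f p \<in> Rc (?f p')"
      then obtain h where h: "h \<in> I" "?f p = h ** ?f p'" by (auto simp: iwahori_rcoset_def)
      define N where "N = E (b,m,j)"
      have "N ** matrix_inv N = mat 1" unfolding N_def by (rule SL2_inv[OF eta_rep_SL2])
      then have "T ** upper (r p) = h ** T ** upper (r p')"
        using h(2) by (metis N_def matrix_mul_assoc matrix_mul_rid)
      then have "T ** upper (r p) ** upper (- r p') ** E ?\<alpha> =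
          h ** (T ** (upper (r p') ** upper (- r p')) ** E ?\<alpha>)"
        by (simp only: matrix_mul_assoc)
      also have "\<dots> = h" by (simp only: finite_reflection.u_inverse matrix_mul_rid T)
      finally have "T ** upper (r p) ** upper (- r p') ** E ?\<alpha> \<in> I" using h by simp
      then have O: "(r p - r p') / t1 / t1 \<in> \<O>"
        by (simp add: T_def upper_def mat2_in_iwahori field_simps)
      then have "(r p - r p') / t1 \<in> \<M>" unfolding divide_t1 .
      moreover have eq: "(r p - r p') / t1 = (lift (fst p) - lift (fst p')) / t1 + (lift (snd p) - lift (snd p'))"
        by (simp add: r_def field_simps)
      ultimately have "(lift (fst p) - lift (fst p')) / t1 \<in> \<O>"
        using O_diff[OF M_imp_O, of "(r p - r p') / t1" "lift (snd p) - lift (snd p')"]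
        by (simp add: lift O_diff)
      then have fst: "fst p = fst p'" by (simp add: divide_t1 lift_diff_M)
      then have "lift (snd p) - lift (snd p') \<in> \<M>"
        using \<open>(r p - r p') / t1 \<in> \<M>\<close> eq by simp
      then show "p = p'" using fst by (simp add: lift_diff_M prod_eq_iff)
    qed
    then show ?thesis by (auto simp: B_def assms(1) split: if_splits)
  qed
  have "chi_conv v t1 t2 q ?\<alpha> (a,i,j) = (of_nat (q * q) / of_nat q) \<cdot>\<^sub>f chi v t1 t2 (a,i+1,j)"
  proof (rule chi_conv_single)
    fix \<gamma> :: bruhat_index
    assume "snd (snd \<gamma>) = snd (snd ?\<alpha>) + snd (snd (a,i,j))"
    then obtain b m where "\<gamma> = (b, m, j)" by (cases \<gamma>) auto
    then show "coset_count ?\<alpha> (a,i,j) \<gamma> = (if \<gamma> = (a,i+1,j) then q * q else 0)"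
      using count by simp
  qed simp_all
  moreover have "q > 0" using assms(1) by simp
  ultimately show ?thesis by simp
qed

section \<open>The steps of additive length\<close>

lemma conv_finite_affine: "chi_conv v t1 t2 q (2,0,0) (2,-1,0) = (1 / of_nat q) \<cdot>\<^sub>f chi v t1 t2 (1,1,0)"
proof (rule affine_reflection.conv_length_additive[where c = "mat2 (-1) 0 0 (-1)"])
  fix x assume x: "x \<in> \<O>"
  have "E (2,0,0) ** lower x = upper (- (t1 * x)) ** E (2,0,0)"
    by (simp add: lower_def upper_def mat2_eq_iff)
  moreover have "upper (- (t1 * x)) \<in> I"
    using x t1_M by (intro finite_reflection.u_I) (simp add: O_mult M_imp_O)
  ultimately show "\<exists>k\<in>I. E (2,0,0) ** lower x = k ** E (2,0,0)" by blast
qed (simp_all add: mat2_in_iwahori mat2_eq_iff)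

text \<open>Here and in the next lemma, conjugating the root subgroup by \<open>\<eta>\<close> multiplies its
  off-diagonal entry, up to sign, by \<open>(t2 / t1)\<^sup>2\<close>, which moves it into \<open>\<M>\<close>.\<close>
lemma conv_antidiagonal_finite:
  "chi_conv v t1 t2 q (2,1,-1) (2,0,0) = (1 / of_nat q) \<cdot>\<^sub>f chi v t1 t2 (1,1,-1)"
proof (rule finite_reflection.conv_length_additive[where c = "mat2 (-1) 0 0 (-1)"])
  fix x assume x: "x \<in> \<O>"
  let ?y = "- (x * (t2 / t1) * (t2 / t1))"
  have "E (2,1,-1) ** upper x = mat2 1 0 ?y 1 ** E (2,1,-1)"
    by (simp add: upper_def mat2_eq_iff field_simps)
  moreover have r: "t2 / t1 \<in> \<M>" by (simp add: M_iff divide_inverse v_mult v_inverse v_t)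
  have "?y \<in> \<M>" unfolding M_minus using M_mult_right[OF O_mult[OF x M_imp_O[OF r]] r] .
  then have "mat2 1 0 ?y 1 \<in> I" by (simp add: mat2_in_iwahori)
  ultimately show "\<exists>k\<in>I. E (2,1,-1) ** upper x = k ** E (2,1,-1)" by blast
qed (simp_all add: mat2_in_iwahori mat2_eq_iff)

lemma conv_diagonal_affine:
  "chi_conv v t1 t2 q (1,1,-1) (2,-1,0) = (1 / of_nat q) \<cdot>\<^sub>f chi v t1 t2 (2,0,-1)"
proof (rule affine_reflection.conv_length_additive[where c = "mat 1"])
  fix x assume x: "x \<in> \<O>"
  let ?y = "t1 * x * (t2 / t1) * (t2 / t1)"
  have "E (1,1,-1) ** lower x = mat2 1 0 ?y 1 ** E (1,1,-1)"
    by (simp add: lower_def mat2_eq_iff field_simps)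
  moreover have r: "t2 / t1 \<in> \<M>" by (simp add: M_iff divide_inverse v_mult v_inverse v_t)
  have "?y \<in> \<M>"
    using M_mult_right[OF O_mult[OF O_mult[OF M_imp_O[OF t1_M] x] M_imp_O[OF r]] r] .
  then have "mat2 1 0 ?y 1 \<in> I" by (simp add: mat2_in_iwahori)
  ultimately show "\<exists>k\<in>I. E (1,1,-1) ** lower x = k ** E (1,1,-1)" by blast
qed (simp_all add: mat2_eq_iff)

end

section \<open>The relations\<close>

text \<open>The reduction is the composite of the two residue maps. An \<open>x\<close> in the rank two ring either has
  \<open>w x > 0\<close>, and then \<open>r1 x = 0\<close>, or is a \<open>w\<close>-unit, and then the first component of \<open>v x\<close> is \<open>u (r1 x)\<close>.
  So the ring is the preimage of the valuation ring of \<open>u\<close>.\<close>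
lemma rank_two_residue_two_dim_local_field:
  fixes r0 :: "'k1::field \<Rightarrow> 'k0::{field,finite}"
  assumes F: "two_dim_local_field w r1 u r0" and v: "rank_two_valuation w r1 u v"
    and "local_parameters v t1 t2"
  shows "rank_two_residue v t1 t2 (\<lambda>x. r0 (r1 x))"
proof
  have r1: "residue_map w r1" and r0: "residue_map u r0"
    using F by (auto simp: two_dim_local_field_def)
  have w: "snd (v x) = w x" if "x \<noteq> 0" for x
    using v that by (simp add: rank_two_valuation_def)
  have u: "fst (v x) = u (r1 x)" if "x \<noteq> 0" "w x = 0" for x
    using v that by (simp add: rank_two_valuation_def)
  have r1_zero: "r1 x = 0 \<longleftrightarrow> x = 0 \<or> 0 < w x" if "x \<in> valuation_ring w" for x
    using r1 that by (simp add: residue_map_def)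
  have r0_zero: "r0 x = 0 \<longleftrightarrow> x = 0 \<or> 0 < u x" if "x \<in> valuation_ring u" for x
    using r0 that by (simp add: residue_map_def)
  have O1: "x \<in> valuation_ring w" "r1 x \<in> valuation_ring u" if "x \<in> rank_two_ring v" for x
  proof -
    show "x \<in> valuation_ring w"
      using that w[of x]
      by (cases "x = 0"; cases "v x")
         (auto simp: rank_two_ring_def rlex_le_def rlex_less_def valuation_ring_def)
    then show "r1 x \<in> valuation_ring u"
      using that w[of x] u[of x] r1_zero[of x]
      by (cases "x = 0"; cases "v x") (auto simp: rank_two_ring_def rlex_le_def rlex_less_def valuation_ring_def)
  qed
  have O2: "x \<in> rank_two_ring v" if "x \<in> valuation_ring w" "r1 x \<in> valuation_ring u" for x
    using that w[of x] u[of x] r1_zero[of x]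
    by (cases "x = 0"; cases "w x = 0")
       (auto simp: rank_two_ring_def rlex_le_def rlex_less_def valuation_ring_def prod_eq_iff)
  fix x y :: 'a
  show "v (x * y) = v x + v y" if "x \<noteq> 0" "y \<noteq> 0"
    using v that by (simp add: rank_two_valuation_def)
  show "rlex_le (v x) (v (x + y)) \<or> rlex_le (v y) (v (x + y))" if "x \<noteq> 0" "y \<noteq> 0" "x + y \<noteq> 0"
    using v that by (simp add: rank_two_valuation_def)
  show "local_parameters v t1 t2" by fact
  show "(\<lambda>x. r0 (r1 x)) ` rank_two_ring v = UNIV"
  proof (intro equalityI subsetI)
    fix k :: 'k0
    obtain y where y: "y \<in> valuation_ring u" "r0 y = k"
      using r0 unfolding residue_map_def by (metis UNIV_I imageE)
    obtain x where x: "x \<in> valuation_ring w" "r1 x = y"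
      using r1 unfolding residue_map_def by (metis UNIV_I imageE)
    show "k \<in> (\<lambda>x. r0 (r1 x)) ` rank_two_ring v" using O2[of x] x y by blast
  qed simp
  show "r0 (r1 (x + y)) = r0 (r1 x) + r0 (r1 y)" if "x \<in> rank_two_ring v" "y \<in> rank_two_ring v"
    using O1[OF that(1)] O1[OF that(2)] r0 r1 by (simp add: residue_map_def)
  show "r0 (r1 x) = 0 \<longleftrightarrow> x = 0 \<or> rlex_less (0, 0) (v x)" if "x \<in> rank_two_ring v"
    using O1[OF that] that r0_zero[of "r1 x"] r1_zero[of x] w[of x] u[of x]
    by (cases "x = 0"; cases "w x = 0")
       (auto simp: rank_two_ring_def rlex_le_def rlex_less_def valuation_ring_def)
qed

lemma fun_scale_scale: "a \<cdot>\<^sub>f b \<cdot>\<^sub>f f = (a * b) \<cdot>\<^sub>f f"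
  by (simp add: fun_scale_def mult.assoc)

theorem proposition3p7:
  fixes w :: "'f::field \<Rightarrow> int" and r1 :: "'f \<Rightarrow> 'k1::field"
    and u :: "'k1 \<Rightarrow> int" and r0 :: "'k1 \<Rightarrow> 'k0::{field,finite}"
    and v :: "'f \<Rightarrow> int \<times> int" and t1 t2 :: 'f and q :: nat
    and hmult :: "('f^2^2 \<Rightarrow> complex) \<Rightarrow> ('f^2^2 \<Rightarrow> complex) \<Rightarrow> 'f^2^2 \<Rightarrow> complex"  (infixl "\<star>" 70)
    and \<phi>\<^sub>0 \<phi>\<^sub>1 \<phi>\<^sub>2 \<iota> :: "'f^2^2 \<Rightarrow> complex"
  assumes "two_dim_local_field w r1 u r0"
    and "q = CARD('k0)"
    and "rank_two_valuation w r1 u v"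
    and "local_parameters v t1 t2"
    and "hmult = hecke_mult v t1 t2 q"
    and "\<phi>\<^sub>0 = complex_of_real (sqrt q) \<cdot>\<^sub>f chi v t1 t2 (2, 0, 0)"
    and "\<phi>\<^sub>1 = complex_of_real (sqrt q) \<cdot>\<^sub>f chi v t1 t2 (2, -1, 0)"
    and "\<phi>\<^sub>2 = complex_of_real (sqrt q) \<cdot>\<^sub>f chi v t1 t2 (2, 0, -1)"
    and "\<iota> = of_nat q \<cdot>\<^sub>f chi v t1 t2 (1, 0, 0)"
  shows "{\<phi>\<^sub>0, \<phi>\<^sub>1, \<phi>\<^sub>2, \<iota>} \<subseteq> hecke_space v t1 t2
    \<and> \<phi>\<^sub>0 \<star> \<phi>\<^sub>0 = complex_of_real (sqrt q - 1 / sqrt q) \<cdot>\<^sub>f \<phi>\<^sub>0 + \<iota>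
    \<and> \<phi>\<^sub>1 \<star> \<phi>\<^sub>1 = complex_of_real (sqrt q - 1 / sqrt q) \<cdot>\<^sub>f \<phi>\<^sub>1 + \<iota>
    \<and> \<phi>\<^sub>0 \<star> \<phi>\<^sub>1 \<star> \<phi>\<^sub>2 \<star> \<phi>\<^sub>0 \<star> \<phi>\<^sub>1 = \<phi>\<^sub>2"
proof -
  interpret rank_two_residue v t1 t2 "\<lambda>x. r0 (r1 x)"
    using assms(1,3,4) by (rule rank_two_residue_two_dim_local_field)
  define \<omega> where "\<omega> = complex_of_real (sqrt q)"
  have \<phi>: "\<phi>\<^sub>0 = \<omega> \<cdot>\<^sub>f chi v t1 t2 (2, 0, 0)" "\<phi>\<^sub>1 = \<omega> \<cdot>\<^sub>f chi v t1 t2 (2, -1, 0)"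
    "\<phi>\<^sub>2 = \<omega> \<cdot>\<^sub>f chi v t1 t2 (2, 0, -1)"
    using assms(6-8) by (simp_all add: \<omega>_def)
  have "q > 0" using assms(2) by simp
  then have [simp]: "\<omega> \<noteq> 0" by (simp add: \<omega>_def)
  have q: "of_nat q = \<omega> * \<omega>" by (simp add: \<omega>_def flip: of_real_mult)
  have scalar: "complex_of_real (sqrt q - 1 / sqrt q) = (\<omega> * \<omega> - 1) / \<omega>"
    by (simp add: \<omega>_def[symmetric] field_simps)
  have quadratic: "\<omega> \<cdot>\<^sub>f X \<star> \<omega> \<cdot>\<^sub>f X = complex_of_real (sqrt q - 1 / sqrt q) \<cdot>\<^sub>f (\<omega> \<cdot>\<^sub>f X) + \<iota>"
    if "X = chi v t1 t2 \<sigma>" "chi_conv v t1 t2 q \<sigma> \<sigma> =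
      chi v t1 t2 (1,0,0) + ((of_nat q - 1) / of_nat q) \<cdot>\<^sub>f chi v t1 t2 \<sigma>" for X \<sigma>
    unfolding assms(5,9) that hecke_mult_chi scalar q
    by (simp add: fun_scale_def fun_eq_iff field_simps)
  have "\<phi>\<^sub>0 \<star> \<phi>\<^sub>1 = 1 \<cdot>\<^sub>f chi v t1 t2 (1,1,0)"
    unfolding assms(5) \<phi> hecke_mult_chi conv_finite_affine fun_scale_scale q by simp
  moreover have "(1 \<cdot>\<^sub>f chi v t1 t2 (1,1,0)) \<star> \<phi>\<^sub>2 = \<omega> ^ 3 \<cdot>\<^sub>f chi v t1 t2 (2,1,-1)"
    unfolding assms(5) \<phi> hecke_mult_chi conv_translation[OF assms(2), of "-1", simplified]
      fun_scale_scale q by (simp add: power3_eq_cube mult.assoc)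
  moreover have "(\<omega> ^ 3 \<cdot>\<^sub>f chi v t1 t2 (2,1,-1)) \<star> \<phi>\<^sub>0 = \<omega> ^ 2 \<cdot>\<^sub>f chi v t1 t2 (1,1,-1)"
    unfolding assms(5) \<phi> hecke_mult_chi conv_antidiagonal_finite fun_scale_scale q
    by (simp add: power3_eq_cube power2_eq_square)
  moreover have "(\<omega> ^ 2 \<cdot>\<^sub>f chi v t1 t2 (1,1,-1)) \<star> \<phi>\<^sub>1 = \<phi>\<^sub>2"
    unfolding assms(5) \<phi> hecke_mult_chi conv_diagonal_affine fun_scale_scale q
    by (simp add: power2_eq_square)
  ultimately have "\<phi>\<^sub>0 \<star> \<phi>\<^sub>1 \<star> \<phi>\<^sub>2 \<star> \<phi>\<^sub>0 \<star> \<phi>\<^sub>1 = \<phi>\<^sub>2" by simp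
  moreover have "\<phi>\<^sub>0 \<star> \<phi>\<^sub>0 = complex_of_real (sqrt q - 1 / sqrt q) \<cdot>\<^sub>f \<phi>\<^sub>0 + \<iota>"
    unfolding \<phi> using finite_reflection.conv_quadratic[OF assms(2)] by (intro quadratic) auto
  moreover have "\<phi>\<^sub>1 \<star> \<phi>\<^sub>1 = complex_of_real (sqrt q - 1 / sqrt q) \<cdot>\<^sub>f \<phi>\<^sub>1 + \<iota>"
    unfolding \<phi> using affine_reflection.conv_quadratic[OF assms(2)] by (intro quadratic) auto
  moreover have "{\<phi>\<^sub>0, \<phi>\<^sub>1, \<phi>\<^sub>2, \<iota>} \<subseteq> hecke_space v t1 t2"
    unfolding \<phi> assms(9) using scale_chi_in_hecke_space by blast
  ultimately show ?thesis by blast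
qed

end
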